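(* There exists an absolute constant $C>0$ such that, for every integer $n\ge 1$, with $h=1/n$, and every $x\in[0,1]$, $$\mathcal{M}_{h,3}(x)=C\,\|K_{h,x}\|_{L^2[0,1]}=C\left(\int_0^1 |K_{h,x}(u)|^2\,du\right)^{1/2},$$ i.e. the mixed power function value $\mathcal{M}_{h,3}(x)$ is a constant multiple of the $L^2[0,1]$-norm of the Peano kernel $K_{h,x}$ of the error functional at $x$ for univariate thin plate spline interpolation.
   Context: Let $\phi_2:\mathbb{R}\to\mathbb{R}$, $\phi_2(x)=|x|^2\log|x|$ (with $\phi_2(0)=0$), be the thin plate spline (TPS) basis function. Let $n\ge1$ be an integer and $h=1/n$. TPS Lagrange functions: for each $j\in\{0,1,\ldots,n\}$, $\ell^{(2)}_{j,h}$ denotes the unique function of the form $$\ell^{(2)}_{j,h}(x)=\sum_{k=0}^n a_k\,\phi_2(x-hk)+b_0+b_1x,\quad x\in\mathbb{R},$$ with real coefficients satisfying the side conditions $\sum_{k=0}^n a_k=0$ and $\sum_{k=0}^n k\,a_k=0$, and the interpolation conditions $\ell^{(2)}_{j,h}(ih)=\delta_{ij}$ for $i=0,1,\ldots,n$. (Existence and uniqueness are known from Micchelli's theory of conditionally positive definite functions.) As a known consequence, $\sum_{j=0}^n\ell^{(2)}_{j,h}(x)=1$ and $\sum_{j=0}^n hj\,\ell^{(2)}_{j,h}(x)=x$ for all $x\in\mathbb{R}$. For $x\in\mathbb{R}$ define $$\Theta_{x,2}(t)=e^{ixt}-\sum_{j=0}^n \ell^{(2)}_{j,h}(x)\,e^{ihjt},\quad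 t\in\mathbb{R}.$$ The mixed power function (for $\mu=3$) is the function $\mathcal{M}_{h,3}:\mathbb{R}\to[0,\infty)$ given by $$\mathcal{M}_{h,3}^2(x)=\frac{|A_3|}{2\pi}\int_{\mathbb{R}}\frac{|\Theta_{x,2}(t)|^2}{|t|^4}\,dt,$$ the integral being absolutely convergent. Here $A_3$ is the nonzero real constant such that the generalized (distributional) Fourier transform of $\phi_3(x)=|x|^3$, with the convention $\widehat g(t)=\int_{\mathbb{R}}e^{-ixt}g(x)\,dx$, coincides with $A_3/|t|^4$ on $\mathbb{R}\setminus\{0\}$ (in fact $A_3>0$). The Peano kernel is $$K_{h,x}(u)=(x-u)_+-\sum_{j=0}^n \ell^{(2)}_{j,h}(x)\,(hj-u)_+,\quad u\in\mathbb{R},$$ where $y_+=\max\{y,0\}$. *)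

theory Defs
  imports "HOL-Analysis.Analysis"
begin

text \<open>Throughout, \<open>n\<close> determines the grid spacing \<open>h = 1 / n\<close>, and everything that depends
  on \<open>h\<close> is indexed by \<open>n\<close>.\<close>

definition tps :: "real \<Rightarrow> real" where
  "tps x = (if x = 0 then 0 else \<bar>x\<bar>^2 * ln \<bar>x\<bar>)"

definition is_tps_lagrange :: "nat \<Rightarrow> nat \<Rightarrow> (real \<Rightarrow> real) \<Rightarrow> bool" where
  "is_tps_lagrange n j f \<longleftrightarrow>
     (\<exists>(a :: nat \<Rightarrow> real) b0 b1.
        (\<forall>x. f x = (\<Sum>k=0..n. a k * tps (x - (1 / real n) * real k)) + b0 + b1 * x) \<and>
        (\<Sum>k=0..n. a k) = 0 \<and> (\<Sum>k=0..n. real k * a k) = 0) \<and>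
     (\<forall>i\<in>{0..n}. f (real i * (1 / real n)) = (if i = j then 1 else 0))"

definition tps_lagrange :: "nat \<Rightarrow> nat \<Rightarrow> real \<Rightarrow> real" where
  "tps_lagrange n j = (THE f. is_tps_lagrange n j f)"

definition Theta :: "nat \<Rightarrow> real \<Rightarrow> real \<Rightarrow> complex" where
  "Theta n x t =
     exp (\<i> * complex_of_real (x * t)) -
     (\<Sum>j=0..n. complex_of_real (tps_lagrange n j x) *
        exp (\<i> * complex_of_real ((1 / real n) * real j * t)))"

definition fourier :: "(real \<Rightarrow> complex) \<Rightarrow> real \<Rightarrow> complex" where
  "fourier g t = (LINT x|lborel. exp (- (\<i> * complex_of_real (x * t))) * g x)"

definition smooth_fun :: "(real \<Rightarrow> complex) \<Rightarrow> bool" where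
  "smooth_fun g \<longleftrightarrow>
     (\<exists>D :: nat \<Rightarrow> real \<Rightarrow> complex.
        D 0 = g \<and> (\<forall>k t. (D k has_vector_derivative D (Suc k) t) (at t)))"

definition test_fun_on :: "real set \<Rightarrow> (real \<Rightarrow> complex) \<Rightarrow> bool" where
  "test_fun_on U g \<longleftrightarrow>
     smooth_fun g \<and> compact (closure {t. g t \<noteq> 0}) \<and> closure {t. g t \<noteq> 0} \<subseteq> U"

text \<open>The Fourier transform of the tempered distribution induced by a function \<open>f\<close> of polynomial
  growth is the functional sending a test function \<open>g\<close> to the integral of \<open>f\<close> times the Fourier
  transform of \<open>g\<close>. It coincides on the open set \<open>U\<close> with a function \<open>F\<close>, continuous on \<open>U\<close>, if
  it agrees with integration against \<open>F\<close> on all test functions supported in \<open>U\<close>.\<close>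

definition gen_fourier_eq_on ::
    "real set \<Rightarrow> (real \<Rightarrow> complex) \<Rightarrow> (real \<Rightarrow> complex) \<Rightarrow> bool" where
  "gen_fourier_eq_on U f F \<longleftrightarrow>
     (\<forall>g. test_fun_on U g \<longrightarrow>
        (LINT x|lborel. f x * fourier g x) = (LINT t|lborel. F t * g t))"

definition A3 :: real where
  "A3 = (THE A. gen_fourier_eq_on (UNIV - {0})
           (\<lambda>x. complex_of_real (\<bar>x\<bar>^3)) (\<lambda>t. complex_of_real (A / \<bar>t\<bar>^4)))"

text \<open>The value of the integrand at \<open>t = 0\<close> is immaterial, a point being a null set.\<close>

definition mixed_power :: "nat \<Rightarrow> real \<Rightarrow> real" where
  "mixed_power n x =
     sqrt (\<bar>A3\<bar> / (2 * pi) * (LINT t|lborel. (cmod (Theta n x t))^2 / \<bar>t\<bar>^4))"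

definition peano_kernel :: "nat \<Rightarrow> real \<Rightarrow> real \<Rightarrow> real" where
  "peano_kernel n x u =
     max (x - u) 0 -
     (\<Sum>j=0..n. tps_lagrange n j x * max ((1 / real n) * real j - u) 0)"

end

theory Submission
  imports Defs "HOL-Probability.Sinc_Integral" "Jordan_Normal_Form.Determinant"
begin

text \<open>With nodes \<open>y\<^sub>i\<close> (the grid points and \<open>x\<close>) and weights \<open>c\<^sub>i\<close> (the negated Lagrange values and
  \<open>1\<close>), both sides of the identity are multiples of \<open>Q = \<Sum>\<^sub>i \<Sum>\<^sub>j c\<^sub>i c\<^sub>j \<bar>y\<^sub>i - y\<^sub>j\<bar>\<^sup>3\<close>, so that Plancherel's
  theorem is not needed. Reproduction of affine functions gives \<open>\<Sum> c\<^sub>i = \<Sum> c\<^sub>i y\<^sub>i = 0\<close>. Hence \<open>cos s\<close> may be replaced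
  by \<open>cos s - 1 + s\<^sup>2/2\<close> in the expansion of \<open>\<bar>\<Theta>\<bar>\<^sup>2\<close>, and the substitution \<open>s = (y\<^sub>i - y\<^sub>j) t\<close> makes the integral
  of \<open>\<bar>\<Theta>\<bar>\<^sup>2 / t\<^sup>4\<close> a positive constant times \<open>Q\<close>; likewise the integral of
  \<open>(y\<^sub>i - u)\<^sub>+ (y\<^sub>j - u)\<^sub>+\<close> over \<open>[0,1]\<close> is \<open>\<bar>y\<^sub>i - y\<^sub>j\<bar>\<^sup>3 / 12\<close> up to terms annihilated by the moment conditions.
  The Lagrange functions exist because the same argument with \<open>\<bar>t\<bar>\<^sup>3\<close> in place of \<open>t\<^sup>4\<close> represents the quadratic
  form of the thin plate spline as an integral of a squared exponential sum. Finally \<open>A3 = 12\<close>: for a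
  test function \<open>g\<close> supported away from \<open>0\<close>, the Fourier transform of \<open>g\<close> is the fourth derivative of
  that of \<open>g(t) / t\<^sup>4\<close>, and one integrates by parts against \<open>\<bar>x\<bar>\<^sup>3\<close>.\<close>

section \<open>Integrals of regularized cosines\<close>

lemma cos_ge_quadratic: "0 \<le> cos s - 1 + s\<^sup>2 / 2" for s :: real
proof -
  have "(sin (s / 2))\<^sup>2 \<le> (s / 2)\<^sup>2"
    using abs_sin_x_le_abs_x[of "s / 2"] by (simp only: abs_le_square_iff)
  moreover have "cos s = 1 - 2 * (sin (s / 2))\<^sup>2"
    using cos_double_sin[of "s / 2"] by simp
  ultimately show ?thesis
    by (simp add: power_divide)
qed

text \<open>Taylor's formula with remainder bounds the left side by \<open>s^4 / 24\<close>. The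
  cruder constant 1 is enough, because the bound only serves to prove integrability near 0.\<close>

lemma cos_le_quartic: "cos s - 1 + s\<^sup>2 / 2 \<le> s ^ 4" for s :: real
proof -
  obtain t where t: "cos s = (\<Sum>m<4. cos_coeff m * s ^ m) + cos (t + 1 / 2 * real 4 * pi) / fact 4 * s ^ 4"
    using Maclaurin_cos_expansion[of s 4] by blast
  define q where "q = cos (t + 1 / 2 * real 4 * pi)"
  have "(\<Sum>m<4. cos_coeff m * s ^ m) = 1 - s\<^sup>2 / 2"
    by (simp add: eval_nat_numeral cos_coeff_Suc sin_coeff_Suc)
  moreover have "fact 4 = (24 :: real)"
    by (simp add: eval_nat_numeral)
  ultimately have "cos s = 1 - s\<^sup>2 / 2 + q * s ^ 4 / 24"
    using t unfolding q_def by simp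
  moreover have "q * s ^ 4 \<le> 1 * s ^ 4"
    unfolding q_def by (intro mult_right_mono) auto
  moreover have "0 \<le> s ^ 4"
    by simp
  ultimately show ?thesis
    by linarith
qed

text \<open>The majorant \<open>2 * C / (1 + s^2)\<close> is at least \<open>C\<close> on [-1,1] and
  at least \<open>C / s^2\<close> outside.\<close>

lemma integrable_le_inverse_1_plus_square:
  fixes f :: "real \<Rightarrow> real"
  assumes [measurable]: "f \<in> borel_measurable borel"
    and near: "\<And>s. \<bar>s\<bar> \<le> 1 \<Longrightarrow> \<bar>f s\<bar> \<le> C" and far: "\<And>s. 1 < \<bar>s\<bar> \<Longrightarrow> \<bar>f s\<bar> \<le> C / s\<^sup>2"
  shows "integrable lborel f"
proof (rule Bochner_Integration.integrable_bound)
  show "integrable lborel (\<lambda>s. 2 * C * inverse (1 + s\<^sup>2))"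
    using integrable_inverse_1_plus_square by (simp add: set_integrable_def)
  have "0 \<le> C"
    using near[of 0] by simp
  have "\<bar>f s\<bar> \<le> 2 * C * inverse (1 + s\<^sup>2)" for s
  proof (cases "\<bar>s\<bar> \<le> 1")
    case True
    then have "s\<^sup>2 \<le> 1"
      by (simp add: abs_square_le_1)
    then have "C * (1 + s\<^sup>2) \<le> C * 2"
      using \<open>0 \<le> C\<close> by (intro mult_left_mono) auto
    then have "C \<le> 2 * C * inverse (1 + s\<^sup>2)"
      by (simp add: field_simps add_pos_nonneg)
    then show ?thesis
      using near[OF True] by linarith
  next
    case False
    then have s: "1 < s\<^sup>2"
      using one_less_power[of "\<bar>s\<bar>" 2] by simp
    then have "C * (1 + s\<^sup>2) \<le> C * (2 * s\<^sup>2)"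
      using \<open>0 \<le> C\<close> by (intro mult_left_mono) auto
    then have "C / s\<^sup>2 \<le> 2 * C * inverse (1 + s\<^sup>2)"
      using s by (auto simp: divide_simps mult_ac)
    then show ?thesis
      using far[of s] False by linarith
  qed
  then show "AE s in lborel. norm (f s) \<le> norm (2 * C * inverse (1 + s\<^sup>2))"
    using \<open>0 \<le> C\<close> by (simp add: add_nonneg_nonneg)
qed (use assms in simp)

definition cos_quartic_integral :: real where
  "cos_quartic_integral = (LINT s|lborel. (cos s - 1 + s\<^sup>2 / 2) / \<bar>s\<bar> ^ 4)"

lemma integrable_cos_quartic: "integrable lborel (\<lambda>s::real. (cos s - 1 + s\<^sup>2 / 2) / \<bar>s\<bar> ^ 4)"
proof (rule integrable_le_inverse_1_plus_square[where C = 1])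
  fix s :: real
  have "\<bar>(cos s - 1 + s\<^sup>2 / 2) / \<bar>s\<bar> ^ 4\<bar> = (cos s - 1 + s\<^sup>2 / 2) / s ^ 4"
    using cos_ge_quadratic[of s] by simp
  moreover have "(cos s - 1 + s\<^sup>2 / 2) / s ^ 4 \<le> 1"
    using cos_le_quartic[of s] by (cases "s = 0") (simp_all add: divide_le_eq)
  moreover have "(cos s - 1 + s\<^sup>2 / 2) / s ^ 4 \<le> 1 / s\<^sup>2"
  proof (cases "s = 0")
    case False
    have "(cos s - 1 + s\<^sup>2 / 2) / s ^ 4 \<le> s\<^sup>2 / s ^ 4"
      by (intro divide_right_mono) (use cos_le_one[of s] zero_le_power2[of s] in \<open>linarith, simp\<close>)
    then show ?thesis
      using False by (simp add: power2_eq_square power4_eq_xxxx divide_simps)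
  qed simp
  ultimately show "\<bar>(cos s - 1 + s\<^sup>2 / 2) / \<bar>s\<bar> ^ 4\<bar> \<le> 1"
    and "\<bar>(cos s - 1 + s\<^sup>2 / 2) / \<bar>s\<bar> ^ 4\<bar> \<le> 1 / s\<^sup>2"
    by (simp_all only:)
qed simp

text \<open>The integrand is nonnegative, and on [3,4] it is at least 1/256: there the numerator is
  at least -2 + 9/2, which exceeds 1, while \<open>s^4\<close> is at most 256.\<close>

lemma cos_quartic_integral_pos: "0 < cos_quartic_integral"
proof -
  have "(LINT s|lborel. indicator {3..4::real} s / 256 :: real) \<le> cos_quartic_integral"
    unfolding cos_quartic_integral_def
  proof (intro integral_mono integrable_cos_quartic)
    show "integrable lborel (\<lambda>s. indicator {3..4::real} s / 256 :: real)"
      by (intro integrable_divide_zero impI integrable_real_indicator) auto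
    fix s :: real
    show "indicator {3..4} s / 256 \<le> (cos s - 1 + s\<^sup>2 / 2) / \<bar>s\<bar> ^ 4"
    proof (cases "s \<in> {3..4}")
      case True
      have "s ^ 4 \<le> 256" "9 \<le> s\<^sup>2"
        using True power_mono[of s 4 4] power_mono[of 3 s 2] by auto
      then have "1 * s ^ 4 \<le> (cos s - 1 + s\<^sup>2 / 2) * 256"
        using cos_ge_minus_one[of s] by argo
      then show ?thesis
        using True by (simp add: field_simps)
    qed (use cos_ge_quadratic[of s] in simp)
  qed
  then show ?thesis
    by simp
qed

lemma has_bochner_integral_cos_quartic:
  "has_bochner_integral lborel (\<lambda>t. (cos (d * t) - 1 + (d * t)\<^sup>2 / 2) / \<bar>t\<bar> ^ 4) (cos_quartic_integral * \<bar>d\<bar> ^ 3)"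
proof (cases "d = 0")
  case False
  let ?f = "\<lambda>s::real. (cos s - 1 + s\<^sup>2 / 2) / \<bar>s\<bar> ^ 4"
  have "has_bochner_integral lborel ?f cos_quartic_integral"
    using integrable_cos_quartic by (simp add: has_bochner_integral_iff cos_quartic_integral_def)
  then have "has_bochner_integral lborel (\<lambda>t. ?f (0 + d * t)) (cos_quartic_integral /\<^sub>R \<bar>d\<bar>)"
    using lborel_has_bochner_integral_real_affine_iff[OF False, of ?f _ 0] by blast
  then have "has_bochner_integral lborel (\<lambda>t. d ^ 4 * ?f (0 + d * t)) (d ^ 4 * (cos_quartic_integral /\<^sub>R \<bar>d\<bar>))"
    by (intro has_bochner_integral_mult_right)
  moreover have "d ^ 4 * ?f (0 + d * t) = (cos (d * t) - 1 + (d * t)\<^sup>2 / 2) / \<bar>t\<bar> ^ 4" for t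
    using False by (simp add: abs_mult power_mult_distrib)
  moreover have "d ^ 4 * (cos_quartic_integral /\<^sub>R \<bar>d\<bar>) = cos_quartic_integral * \<bar>d\<bar> ^ 3"
    using False by (simp add: power4_eq_xxxx power3_eq_cube field_simps abs_if)
  ultimately show ?thesis
    by (simp only:)
qed (simp add: has_bochner_integral_zero)

text \<open>The quadratic term would make the integral diverge at infinity and is therefore cut off;
  rescaling the cutoff is what produces the logarithm of the thin plate spline.\<close>

definition cos_cubic_integral :: real where
  "cos_cubic_integral =
     (LINT s|lborel. (cos s - 1 + s\<^sup>2 / 2 * indicator {-1<..<1} s) / \<bar>s\<bar> ^ 3)"

lemma integrable_cos_cubic:
  "integrable lborel (\<lambda>s::real. (cos s - 1 + s\<^sup>2 / 2 * indicator {-1<..<1} s) / \<bar>s\<bar> ^ 3)"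
proof (rule integrable_le_inverse_1_plus_square[where C = 2])
  fix s :: real
  have far: "\<bar>(cos s - 1) / \<bar>s\<bar> ^ 3\<bar> \<le> 2 / \<bar>s\<bar> ^ 3"
    by (simp add: abs_divide power_abs[symmetric] del: power_abs)
      (intro divide_right_mono, use cos_ge_minus_one[of s] in \<open>auto simp: abs_if\<close>)
  show "\<bar>(cos s - 1 + s\<^sup>2 / 2 * indicator {-1<..<1} s) / \<bar>s\<bar> ^ 3\<bar> \<le> 2" if "\<bar>s\<bar> \<le> 1"
  \<comment> \<open>The cutoff interval is open, so the quadratic term is absent at
    \<open>|s| = 1\<close> and the bound for large \<open>s\<close> applies there.\<close>
  proof (cases "\<bar>s\<bar> = 1")
    case True
    then have "indicator {-1<..<1} s = (0 :: real)"
      by (auto simp: indicator_def)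
    then show ?thesis
      using far True by simp
  next
    case False
    have "(cos s - 1 + s\<^sup>2 / 2) / \<bar>s\<bar> ^ 3 \<le> s ^ 4 / \<bar>s\<bar> ^ 3"
      using cos_le_quartic[of s] by (intro divide_right_mono) simp_all
    also have "\<dots> \<le> \<bar>s\<bar>"
      by (cases "s = 0") (auto simp: power4_eq_xxxx power3_eq_cube field_simps abs_if)
    finally show ?thesis
      using that False cos_ge_quadratic[of s] by (simp add: abs_divide abs_if[of s] split: if_splits)
  qed
  assume "1 < \<bar>s\<bar>"
  then have "\<bar>s\<bar>\<^sup>2 \<le> \<bar>s\<bar> ^ 3"
    by (intro power_increasing) auto
  then have "2 / \<bar>s\<bar> ^ 3 \<le> 2 / s\<^sup>2"
    using \<open>1 < \<bar>s\<bar>\<close> by (intro divide_left_mono) auto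
  then show "\<bar>(cos s - 1 + s\<^sup>2 / 2 * indicator {-1<..<1} s) / \<bar>s\<bar> ^ 3\<bar> \<le> 2 / s\<^sup>2"
    using far \<open>1 < \<bar>s\<bar>\<close> by (auto simp: indicator_def)
qed simp

lemma has_bochner_integral_inverse_annulus:
  assumes "0 < a" "a \<le> b"
  shows "has_bochner_integral lborel (\<lambda>s::real. indicator {s. a \<le> \<bar>s\<bar> \<and> \<bar>s\<bar> < b} s / (2 * \<bar>s\<bar>)) (ln b - ln a)"
proof -
  have "has_bochner_integral lborel (\<lambda>s::real. (1 / (2 * s)) * indicator {a..b} s) (ln b / 2 - ln a / 2)"
    by (intro has_bochner_integral_FTC_Icc_real[where F = "\<lambda>s. ln s / 2"])
      (use assms in \<open>auto intro!: derivative_eq_intros continuous_intros\<close>)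
  then have "has_bochner_integral lborel
      (\<lambda>s. indicator {0..} s *\<^sub>R (indicator {s. a \<le> \<bar>s\<bar> \<and> \<bar>s\<bar> < b} s / (2 * \<bar>s\<bar>))) (ln b / 2 - ln a / 2)"
    \<comment> \<open>The closed interval [a,b] and the half-open annulus differ on the half-line
      only at \<open>b\<close>. Doubling by evenness then removes the division by 2.\<close>
    by (rule has_bochner_integral_discrete_difference[where X = "{b}", THEN iffD1, rotated 4])
      (use assms in \<open>auto simp: indicator_def\<close>)
  from has_bochner_integral_even_function[OF this] show ?thesis
    by (simp add: indicator_def)
qed

text \<open>The two cutoffs differ on the annulus between radii 1 and \<open>d\<close>, where the
  integrand is \<open>1 / (2 * |s|)\<close> with a plus sign for \<open>d >= 1\<close> and a minus
  sign for \<open>d < 1\<close>. Both cases give \<open>ln d\<close>.\<close>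

lemma has_bochner_integral_cutoff_change:
  assumes "0 < d"
  shows "has_bochner_integral lborel
    (\<lambda>s::real. (s\<^sup>2 / 2 * indicator {-d<..<d} s - s\<^sup>2 / 2 * indicator {-1<..<1} s) / \<bar>s\<bar> ^ 3) (ln d)"
    (is "has_bochner_integral lborel ?f _")
proof (cases "1 \<le> d")
  case True
  have "?f = (\<lambda>s::real. indicator {s. 1 \<le> \<bar>s\<bar> \<and> \<bar>s\<bar> < d} s / (2 * \<bar>s\<bar>))"
    using True by (auto simp: indicator_def fun_eq_iff power2_eq_square power3_eq_cube abs_if divide_simps)
  then show ?thesis
    using has_bochner_integral_inverse_annulus[of 1 d] True by simp
next
  case False
  have "?f = (\<lambda>s::real. - (indicator {s. d \<le> \<bar>s\<bar> \<and> \<bar>s\<bar> < 1} s / (2 * \<bar>s\<bar>)))"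
    using False assms by (auto simp: indicator_def fun_eq_iff power2_eq_square power3_eq_cube abs_if divide_simps)
  then show ?thesis
    using has_bochner_integral_minus[OF has_bochner_integral_inverse_annulus[of d 1]] False assms by simp
qed

text \<open>The substitution \<open>s = d * t\<close> turns the cutoff at 1 into a cutoff at
  \<open>|d|\<close>. Returning to the unit cutoff adds \<open>ln |d|\<close>, and the scaling
  factor \<open>|d|^3 / |d| = d^2\<close> makes this summand equal to \<open>tps d\<close>.\<close>

lemma has_bochner_integral_cos_cubic:
  "has_bochner_integral lborel
     (\<lambda>t. (cos (d * t) - 1 + (d * t)\<^sup>2 / 2 * indicator {-1<..<1} t) / \<bar>t\<bar> ^ 3)
     (cos_cubic_integral * d\<^sup>2 + tps d)"
proof (cases "d = 0")
  case False
  let ?f = "\<lambda>s::real. (cos s - 1 + s\<^sup>2 / 2 * indicator {-\<bar>d\<bar><..<\<bar>d\<bar>} s) / \<bar>s\<bar> ^ 3"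
  have "has_bochner_integral lborel
      (\<lambda>s. (cos s - 1 + s\<^sup>2 / 2 * indicator {-1<..<1} s) / \<bar>s\<bar> ^ 3
         + (s\<^sup>2 / 2 * indicator {-\<bar>d\<bar><..<\<bar>d\<bar>} s - s\<^sup>2 / 2 * indicator {-1<..<1} s) / \<bar>s\<bar> ^ 3)
      (cos_cubic_integral + ln \<bar>d\<bar>)"
    by (intro has_bochner_integral_add has_bochner_integral_cutoff_change)
      (use integrable_cos_cubic False in \<open>simp_all add: has_bochner_integral_iff cos_cubic_integral_def\<close>)
  moreover have "(cos s - 1 + s\<^sup>2 / 2 * indicator {-1<..<1} s) / \<bar>s\<bar> ^ 3
      + (s\<^sup>2 / 2 * indicator {-\<bar>d\<bar><..<\<bar>d\<bar>} s - s\<^sup>2 / 2 * indicator {-1<..<1} s) / \<bar>s\<bar> ^ 3 = ?f s" for s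
    by (simp add: diff_divide_distrib add_divide_distrib)
  ultimately have "has_bochner_integral lborel ?f (cos_cubic_integral + ln \<bar>d\<bar>)"
    by (simp only:)
  then have "has_bochner_integral lborel (\<lambda>t. ?f (0 + d * t)) ((cos_cubic_integral + ln \<bar>d\<bar>) /\<^sub>R \<bar>d\<bar>)"
    using lborel_has_bochner_integral_real_affine_iff[OF False, of ?f _ 0] by blast
  then have "has_bochner_integral lborel (\<lambda>t. \<bar>d\<bar> ^ 3 * ?f (0 + d * t))
      (\<bar>d\<bar> ^ 3 * ((cos_cubic_integral + ln \<bar>d\<bar>) /\<^sub>R \<bar>d\<bar>))"
    by (intro has_bochner_integral_mult_right)
  moreover have "indicator {-\<bar>d\<bar><..<\<bar>d\<bar>} (d * t) = (indicator {-1<..<1} t :: real)" for t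
  proof -
    have "\<bar>d * t\<bar> < \<bar>d\<bar> \<longleftrightarrow> \<bar>t\<bar> < 1"
      using False by (simp add: abs_mult)
    then show ?thesis
      unfolding indicator_def by (simp add: abs_less_iff minus_less_iff conj_commute)
  qed
  then have "\<bar>d\<bar> ^ 3 * ?f (0 + d * t) = (cos (d * t) - 1 + (d * t)\<^sup>2 / 2 * indicator {-1<..<1} t) / \<bar>t\<bar> ^ 3" for t
    using False by (simp add: abs_mult power_mult_distrib)
  moreover have "\<bar>d\<bar> ^ 3 * ((cos_cubic_integral + ln \<bar>d\<bar>) /\<^sub>R \<bar>d\<bar>) = cos_cubic_integral * d\<^sup>2 + tps d"
    using False by (simp add: tps_def power2_eq_square power3_eq_cube field_simps abs_if)
  ultimately show ?thesis
    by simp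
qed (simp add: tps_def has_bochner_integral_zero)

section \<open>Weighted integrals of squared exponential sums as quadratic forms\<close>

lemma cmod_exp_sum_squared:
  fixes c y :: "'i \<Rightarrow> real"
  shows "(cmod (\<Sum>i\<in>I. complex_of_real (c i) * exp (\<i> * complex_of_real (y i * t))))\<^sup>2
    = (\<Sum>i\<in>I. \<Sum>j\<in>I. c i * c j * cos ((y i - y j) * t))"
proof -
  let ?P = "\<Sum>i\<in>I. complex_of_real (c i) * exp (\<i> * complex_of_real (y i * t))"
  have "complex_of_real ((cmod ?P)\<^sup>2) = ?P * cnj ?P"
    by (rule complex_norm_square)
  also have "\<dots> = (\<Sum>i\<in>I. \<Sum>j\<in>I. complex_of_real (c i * c j) * exp (\<i> * complex_of_real ((y i - y j) * t)))"
    by (simp add: sum_product exp_cnj algebra_simps flip: exp_add)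
  finally have "(cmod ?P)\<^sup>2 = Re \<dots>"
    by (metis Re_complex_of_real)
  also have "\<dots> = (\<Sum>i\<in>I. \<Sum>j\<in>I. c i * c j * cos ((y i - y j) * t))"
    by (simp add: Re_exp)
  finally show ?thesis .
qed

text \<open>After expanding the square, every term factors into two single sums, at least one of
  which is a vanishing moment.\<close>

lemma sum_products_eq_0:
  fixes c y :: "'i \<Rightarrow> real"
  assumes "(\<Sum>i\<in>I. c i) = 0" "(\<Sum>i\<in>I. c i * y i) = 0"
  shows "(\<Sum>i\<in>I. \<Sum>j\<in>I. c i * c j) = 0" "(\<Sum>i\<in>I. \<Sum>j\<in>I. c i * c j * (y i - y j)\<^sup>2) = 0"
proof -
  show "(\<Sum>i\<in>I. \<Sum>j\<in>I. c i * c j) = 0"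
    using assms by (simp flip: sum_product)
  have "(\<Sum>i\<in>I. \<Sum>j\<in>I. c i * c j * (y i - y j)\<^sup>2) =
      (\<Sum>i\<in>I. \<Sum>j\<in>I. (c i * (y i)\<^sup>2) * c j - 2 * ((c i * y i) * (c j * y j)) + c i * (c j * (y j)\<^sup>2))"
    by (intro sum.cong) (auto simp: algebra_simps power2_eq_square)
  also have "\<dots> = (\<Sum>i\<in>I. c i * (y i)\<^sup>2) * (\<Sum>j\<in>I. c j) - 2 * ((\<Sum>i\<in>I. c i * y i) * (\<Sum>j\<in>I. c j * y j))
      + (\<Sum>i\<in>I. c i) * (\<Sum>j\<in>I. c j * (y j)\<^sup>2)"
    unfolding sum_product by (simp add: sum.distrib sum_subtractf sum_distrib_left)
  finally show "(\<Sum>i\<in>I. \<Sum>j\<in>I. c i * c j * (y i - y j)\<^sup>2) = 0"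
    using assms by simp
qed

text \<open>By the moment conditions, the constant and quadratic corrections of the cosine sum to
  zero. The number \<open>w\<close> stands for the value of the cutoff at \<open>t\<close> and
  \<open>p\<close> for the weight, so that one identity covers both the quartic and the cubic
  case.\<close>

lemma cmod_exp_sum_squared_regularized:
  fixes c y :: "'i \<Rightarrow> real"
  assumes "(\<Sum>i\<in>I. c i) = 0" "(\<Sum>i\<in>I. c i * y i) = 0"
  shows "(cmod (\<Sum>i\<in>I. complex_of_real (c i) * exp (\<i> * complex_of_real (y i * t))))\<^sup>2 / p =
    (\<Sum>i\<in>I. \<Sum>j\<in>I. c i * c j * ((cos ((y i - y j) * t) - 1 + ((y i - y j) * t)\<^sup>2 / 2 * w) / p))"
proof -
  have *: "a * ((k - 1 + (d * t)\<^sup>2 / 2 * w) / p) = a * k / p - a / p + a * d\<^sup>2 * (t\<^sup>2 / 2 * w / p)" for a k d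
    by (simp add: power_mult_distrib algebra_simps add_divide_distrib diff_divide_distrib)
  show ?thesis
    unfolding * cmod_exp_sum_squared sum.distrib sum_subtractf
      sum_divide_distrib[symmetric] sum_distrib_right[symmetric] sum_products_eq_0[OF assms]
    by simp
qed

lemma has_bochner_integral_exp_sum_quartic:
  fixes c y :: "'i \<Rightarrow> real"
  assumes "(\<Sum>i\<in>I. c i) = 0" "(\<Sum>i\<in>I. c i * y i) = 0"
  shows "has_bochner_integral lborel
      (\<lambda>t. (cmod (\<Sum>i\<in>I. complex_of_real (c i) * exp (\<i> * complex_of_real (y i * t))))\<^sup>2 / \<bar>t\<bar> ^ 4)
      (cos_quartic_integral * (\<Sum>i\<in>I. \<Sum>j\<in>I. c i * c j * \<bar>y i - y j\<bar> ^ 3))"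
proof -
  have "has_bochner_integral lborel
      (\<lambda>t. \<Sum>i\<in>I. \<Sum>j\<in>I. c i * c j * ((cos ((y i - y j) * t) - 1 + ((y i - y j) * t)\<^sup>2 / 2) / \<bar>t\<bar> ^ 4))
      (\<Sum>i\<in>I. \<Sum>j\<in>I. c i * c j * (cos_quartic_integral * \<bar>y i - y j\<bar> ^ 3))"
    by (intro has_bochner_integral_sum has_bochner_integral_mult_right has_bochner_integral_cos_quartic)
  then show ?thesis
    using cmod_exp_sum_squared_regularized[OF assms, where w = 1] by (simp add: sum_distrib_left mult_ac)
qed

text \<open>The constant \<open>cos_cubic_integral\<close> multiplies the double sum of
  \<open>c i * c j * (y i - y j)^2\<close>, which is zero, so it drops out and only the spline terms
  remain.\<close>

lemma has_bochner_integral_exp_sum_cubic: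
  fixes c y :: "'i \<Rightarrow> real"
  assumes "(\<Sum>i\<in>I. c i) = 0" "(\<Sum>i\<in>I. c i * y i) = 0"
  shows "has_bochner_integral lborel
      (\<lambda>t. (cmod (\<Sum>i\<in>I. complex_of_real (c i) * exp (\<i> * complex_of_real (y i * t))))\<^sup>2 / \<bar>t\<bar> ^ 3)
      (\<Sum>i\<in>I. \<Sum>j\<in>I. c i * c j * tps (y i - y j))"
proof -
  have "has_bochner_integral lborel
      (\<lambda>t. \<Sum>i\<in>I. \<Sum>j\<in>I. c i * c j *
        ((cos ((y i - y j) * t) - 1 + ((y i - y j) * t)\<^sup>2 / 2 * indicator {-1<..<1} t) / \<bar>t\<bar> ^ 3))
      (\<Sum>i\<in>I. \<Sum>j\<in>I. c i * c j * (cos_cubic_integral * (y i - y j)\<^sup>2 + tps (y i - y j)))"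
    by (intro has_bochner_integral_sum has_bochner_integral_mult_right has_bochner_integral_cos_cubic)
  moreover have "(\<Sum>i\<in>I. \<Sum>j\<in>I. c i * c j * (cos_cubic_integral * (y i - y j)\<^sup>2 + tps (y i - y j))) =
      cos_cubic_integral * (\<Sum>i\<in>I. \<Sum>j\<in>I. c i * c j * (y i - y j)\<^sup>2) + (\<Sum>i\<in>I. \<Sum>j\<in>I. c i * c j * tps (y i - y j))"
    by (simp add: sum_distrib_left sum.distrib algebra_simps)
  ultimately show ?thesis
    unfolding cmod_exp_sum_squared_regularized[OF assms, symmetric] sum_products_eq_0[OF assms] by simp
qed

section \<open>Unisolvency of thin plate spline interpolation\<close>

text \<open>A trivial kernel means a nonzero determinant, hence an inverse matrix. Vectors are
  functions here so that the matrix types stay inside this proof.\<close>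

lemma square_linear_system_solvable:
  fixes M :: "nat \<Rightarrow> nat \<Rightarrow> real"
  assumes "\<And>v. (\<And>i. i < N \<Longrightarrow> (\<Sum>j<N. M i j * v j) = 0) \<Longrightarrow> (\<forall>j<N. v j = 0)"
  obtains v where "\<And>i. i < N \<Longrightarrow> (\<Sum>j<N. M i j * v j) = w i"
proof -
  define A where "A = Matrix.mat N N (\<lambda>(i, j). M i j)"
  have A: "A \<in> carrier_mat N N"
    by (simp add: A_def)
  have mult: "vec_index (A *\<^sub>v u) i = (\<Sum>j<N. M i j * vec_index u j)" if "i < N" "u \<in> carrier_vec N" for u i
    using that by (simp add: A_def scalar_prod_def atLeast0LessThan)
  have "Determinant.det A \<noteq> 0"
  proof
    assume "Determinant.det A = 0"
    then obtain u where u: "u \<in> carrier_vec N" "u \<noteq> 0\<^sub>v N" "A *\<^sub>v u = 0\<^sub>v N"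
      using det_0_iff_vec_prod_zero_field[OF A] by blast
    have "\<forall>j<N. vec_index u j = 0"
      using assms[of "vec_index u"] mult[OF _ u(1)] u(3) by simp
    then have "u = 0\<^sub>v N"
      using u(1) by (intro eq_vecI) auto
    then show False
      using u(2) by simp
  qed
  then obtain B where B: "B \<in> carrier_mat N N" "A * B = 1\<^sub>m N"
    using det_non_zero_imp_unit[OF A, of "()"]
    by (auto simp: Units_def ring_mat_def)
  define u where "u = B *\<^sub>v Matrix.vec N w"
  have u: "u \<in> carrier_vec N"
    using B by (simp add: u_def)
  have "A *\<^sub>v u = (A * B) *\<^sub>v Matrix.vec N w"
    unfolding u_def using A B by (intro assoc_mult_mat_vec[symmetric]) auto
  also have "\<dots> = Matrix.vec N w"
    using B by simp
  finally have "(\<Sum>j<N. M i j * vec_index u j) = w i" if "i < N" for i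
    using mult[OF that u] that by simp
  then show ?thesis
    using that by blast
qed

text \<open>The sum is a polynomial in \<open>exp (i * h * t)\<close>. Its zeros in \<open>t\<close>
  fill [0, 1/h] up to a null set, and on this interval the exponential is injective, since
  \<open>h * t\<close> varies by at most 1, which is less than 2 pi. The polynomial thus has
  infinitely many roots.\<close>

lemma exp_sum_AE_0_imp_coeffs_0:
  fixes a :: "nat \<Rightarrow> real"
  assumes "0 < h"
    and AE: "AE t in lborel. (\<Sum>k\<le>n. complex_of_real (a k) * exp (\<i> * complex_of_real (h * real k * t))) = 0"
    and "k \<le> n"
  shows "a k = 0"
proof -
  let ?P = "\<lambda>z. \<Sum>k\<le>n. complex_of_real (a k) * z ^ k"
  let ?e = "\<lambda>t. exp (\<i> * complex_of_real (h * t))"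
  have P: "(\<Sum>k\<le>n. complex_of_real (a k) * exp (\<i> * complex_of_real (h * real k * t))) = ?P (?e t)" for t
    by (intro sum.cong refl) (simp add: mult_ac flip: exp_of_nat_mult)
  let ?T = "{t. ?P (?e t) = 0} \<inter> {0..1 / h}"
  have "infinite ?T"
  proof
    assume "finite ?T"
    then have "AE t in lborel. t \<notin> ?T"
      by (intro AE_not_in finite_imp_null_set_lborel)
    with AE have "AE t in lborel. t \<notin> {0..1 / h}"
      unfolding P by eventually_elim auto
    then have "emeasure lborel {0..1 / h} = 0"
      by (subst (asm) AE_iff_measurable[OF _ refl]) (auto simp: atLeastAtMost_def atLeast_def atMost_def Collect_conj_eq)
    then show False
      using \<open>0 < h\<close> by simp
  qed
  moreover have "inj_on ?e ?T"
  proof (rule inj_onI)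
    have bounds: "0 \<le> h * r" "h * r \<le> 1" if "r \<in> ?T" for r
      using that \<open>0 < h\<close> by (simp_all add: field_simps)
    fix s t assume "s \<in> ?T" "t \<in> ?T" and eq: "?e s = ?e t"
    then have "\<bar>h * s - h * t\<bar> \<le> 1"
      using bounds[of s] bounds[of t] by linarith
    moreover obtain m :: int where "\<i> * complex_of_real (h * s) = \<i> * complex_of_real (h * t) + (of_int (2 * m) * pi) * \<i>"
      using eq unfolding exp_eq by blast
    then have m: "h * s - h * t = 2 * of_int m * pi"
      by (auto simp: complex_eq_iff)
    ultimately have "\<bar>of_int m\<bar> * (2 * pi) \<le> 1"
      by (simp add: abs_mult mult_ac)
    moreover have "1 * (2 * pi) \<le> \<bar>of_int m\<bar> * (2 * pi)" if "m \<noteq> 0"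
      using that by (intro mult_right_mono) auto
    ultimately have "m = 0"
      using pi_gt3 by linarith
    then show "s = t"
      using m \<open>0 < h\<close> by simp
  qed
  ultimately have "infinite (?e ` ?T)"
    using finite_imageD by blast
  then have "infinite {z. ?P z = 0}"
    by (rule infinite_super[rotated]) auto
  then have "\<forall>k\<le>n. complex_of_real (a k) = 0"
    using polyfun_finite_roots[of "\<lambda>k. complex_of_real (a k)" n] by blast
  then show ?thesis
    using \<open>k \<le> n\<close> by simp
qed

text \<open>This is the conditional positive definiteness of the thin plate spline: the form is the
  integral of a squared exponential sum against \<open>|t|^(-3)\<close>, so it vanishes only if the
  exponential sum is zero almost everywhere.\<close>

lemma tps_quadratic_form_eq_0_imp_coeffs_0:
  fixes a :: "nat \<Rightarrow> real"
  assumes "0 < h" "(\<Sum>k\<le>n. a k) = 0" "(\<Sum>k\<le>n. real k * a k) = 0"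
    and Q: "(\<Sum>i\<le>n. \<Sum>k\<le>n. a i * a k * tps (h * real i - h * real k)) = 0"
    and "k \<le> n"
  shows "a k = 0"
proof -
  let ?P = "\<lambda>t. \<Sum>k\<le>n. complex_of_real (a k) * exp (\<i> * complex_of_real (h * real k * t))"
  have "(\<Sum>k\<le>n. a k * (h * real k)) = h * (\<Sum>k\<le>n. real k * a k)"
    by (simp add: sum_distrib_left mult_ac)
  then have "has_bochner_integral lborel (\<lambda>t. (cmod (?P t))\<^sup>2 / \<bar>t\<bar> ^ 3) 0"
    using has_bochner_integral_exp_sum_cubic[of a "{..n}" "\<lambda>k. h * real k"] assms by simp
  then have "AE t in lborel. (cmod (?P t))\<^sup>2 / \<bar>t\<bar> ^ 3 = 0"
    using integral_nonneg_eq_0_iff_AE[of lborel "\<lambda>t. (cmod (?P t))\<^sup>2 / \<bar>t\<bar> ^ 3"]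
    by (simp add: has_bochner_integral_iff)
  moreover have "AE t in lborel. t \<noteq> (0 :: real)"
    by (rule AE_lborel_singleton)
  ultimately have "AE t in lborel. ?P t = 0"
    by eventually_elim simp
  then show ?thesis
    using exp_sum_AE_0_imp_coeffs_0 assms by blast
qed

section \<open>The spline space, its Lagrange functions and affine reproduction\<close>

definition tps_expansion :: "nat \<Rightarrow> (nat \<Rightarrow> real) \<Rightarrow> real \<Rightarrow> real \<Rightarrow> real \<Rightarrow> real" where
  "tps_expansion n a b0 b1 x = (\<Sum>k=0..n. a k * tps (x - (1 / real n) * real k)) + b0 + b1 * x"

definition tps_space :: "nat \<Rightarrow> (real \<Rightarrow> real) set" where
  "tps_space n = {f. \<exists>a b0 b1. f = tps_expansion n a b0 b1 \<and>
     (\<Sum>k=0..n. a k) = 0 \<and> (\<Sum>k=0..n. real k * a k) = 0}"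

lemma tps_spaceI:
  "(\<Sum>k=0..n. a k) = 0 \<Longrightarrow> (\<Sum>k=0..n. real k * a k) = 0 \<Longrightarrow> tps_expansion n a b0 b1 \<in> tps_space n"
  unfolding tps_space_def by blast

lemma is_tps_lagrange_iff:
  "is_tps_lagrange n j f \<longleftrightarrow>
     f \<in> tps_space n \<and> (\<forall>i\<in>{0..n}. f (real i * (1 / real n)) = (if i = j then 1 else 0))"
  unfolding is_tps_lagrange_def tps_space_def tps_expansion_def by (simp only: mem_Collect_eq fun_eq_iff)

text \<open>Multiplying the \<open>i\<close>-th interpolation condition by \<open>a i\<close> and
  summing removes the affine part through the side conditions. What is left is the quadratic form of
  the spline, which forces \<open>a = 0\<close>. The remaining affine function vanishes at the two
  nodes 0 and \<open>h\<close>, which exist because \<open>n >= 1\<close>.\<close>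

lemma tps_expansion_unisolvent:
  assumes "n \<ge> 1" "(\<Sum>k=0..n. a k) = 0" "(\<Sum>k=0..n. real k * a k) = 0"
    and zero: "\<And>i. i \<le> n \<Longrightarrow> tps_expansion n a b0 b1 (real i * (1 / real n)) = 0"
  shows "\<forall>k\<le>n. a k = 0" "b0 = 0" "b1 = 0"
proof -
  define h where "h = 1 / real n"
  have "h > 0"
    using assms by (simp add: h_def)
  define S where "S i = (\<Sum>k=0..n. a k * tps (h * real i - h * real k))" for i
  have expansion: "tps_expansion n a b0 b1 (real i * (1 / real n)) = S i + b0 + b1 * h * real i" for i
    unfolding tps_expansion_def S_def h_def[symmetric] by (simp only: mult_ac)
  have "0 = (\<Sum>i=0..n. a i * tps_expansion n a b0 b1 (real i * (1 / real n)))"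
    using zero by (intro sum.neutral[symmetric]) auto
  also have "\<dots> = (\<Sum>i=0..n. a i * S i + b0 * a i + b1 * h * (real i * a i))"
    unfolding expansion by (intro sum.cong refl) (simp add: ring_distribs)
  also have "\<dots> = (\<Sum>i=0..n. a i * S i)"
    unfolding sum.distrib sum_distrib_left[symmetric] assms(2,3) by simp
  finally have "(\<Sum>i=0..n. \<Sum>k=0..n. a i * a k * tps (h * real i - h * real k)) = 0"
    unfolding S_def sum_distrib_left by (simp only: mult.assoc)
  then show a: "\<forall>k\<le>n. a k = 0"
    using tps_quadratic_form_eq_0_imp_coeffs_0[OF \<open>h > 0\<close>, of a n] assms(2,3)
    unfolding atLeast0AtMost by blast
  then have "S i = 0" for i
    by (simp add: S_def)
  then show "b0 = 0" "b1 = 0"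
    using zero[of 0] zero[of 1] assms(1) \<open>h > 0\<close> unfolding expansion by simp_all
qed

lemma tps_space_sub_mult:
  assumes "f \<in> tps_space n" "g \<in> tps_space n"
  shows "(\<lambda>x. c * f x + d * g x) \<in> tps_space n"
proof -
  obtain a b0 b1 a' b0' b1' where
    f: "f = tps_expansion n a b0 b1" "(\<Sum>k=0..n. a k) = 0" "(\<Sum>k=0..n. real k * a k) = 0" and
    g: "g = tps_expansion n a' b0' b1'" "(\<Sum>k=0..n. a' k) = 0" "(\<Sum>k=0..n. real k * a' k) = 0"
    using assms unfolding tps_space_def by blast
  have "(\<lambda>x. c * f x + d * g x) =
      tps_expansion n (\<lambda>k. c * a k + d * a' k) (c * b0 + d * b0') (c * b1 + d * b1')"
    unfolding f(1) g(1) tps_expansion_def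
    by (simp add: fun_eq_iff ring_distribs sum.distrib sum_distrib_left mult_ac)
  moreover have "(\<Sum>k=0..n. c * a k + d * a' k) = 0" "(\<Sum>k=0..n. real k * (c * a k + d * a' k)) = 0"
    using f(2,3) g(2,3)
    by (simp_all add: ring_distribs sum.distrib mult.left_commute[of "real _"] flip: sum_distrib_left)
  ultimately show ?thesis
    by (simp add: tps_spaceI)
qed

lemma affine_in_tps_space: "(\<lambda>x. b0 + b1 * x) \<in> tps_space n"
proof -
  have "(\<lambda>x. b0 + b1 * x) = tps_expansion n (\<lambda>_. 0) b0 b1"
    by (simp add: tps_expansion_def fun_eq_iff)
  then show ?thesis
    by (simp add: tps_spaceI)
qed

lemma sum_in_tps_space:
  assumes "\<And>j. j \<in> J \<Longrightarrow> f j \<in> tps_space n"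
  shows "(\<lambda>x. \<Sum>j\<in>J. c j * f j x) \<in> tps_space n"
  using assms
proof (induction J rule: infinite_finite_induct)
  case (insert j J)
  then show ?case
    using tps_space_sub_mult[of "f j" n "\<lambda>x. \<Sum>j\<in>J. c j * f j x" "c j" 1] by simp
qed (use affine_in_tps_space[of 0 0] in simp_all)

lemma tps_space_eqI:
  assumes "n \<ge> 1" "f \<in> tps_space n" "g \<in> tps_space n"
    and "\<And>i. i \<le> n \<Longrightarrow> f (real i * (1 / real n)) = g (real i * (1 / real n))"
  shows "f = g"
proof -
  have "(\<lambda>x. 1 * f x + (- 1) * g x) \<in> tps_space n"
    using assms by (intro tps_space_sub_mult)
  then obtain a b0 b1 where e: "(\<lambda>x. 1 * f x + (- 1) * g x) = tps_expansion n a b0 b1"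
      and a: "(\<Sum>k=0..n. a k) = 0" "(\<Sum>k=0..n. real k * a k) = 0"
    unfolding tps_space_def by blast
  have "tps_expansion n a b0 b1 (real i * (1 / real n)) = 0" if "i \<le> n" for i
    using assms(4)[OF that] by (simp flip: e)
  note z = tps_expansion_unisolvent[OF assms(1) a this]
  then have "tps_expansion n a b0 b1 x = 0" for x
    by (simp add: tps_expansion_def)
  then show ?thesis
    by (simp add: fun_eq_iff flip: e)
qed

text \<open>The unknowns are numbered so that \<open>a\<^sub>0, \<dots>, a\<^sub>n\<close> come first, followed by \<open>b\<^sub>0\<close> and \<open>b\<^sub>1\<close>; the
  last two equations are the side conditions.\<close>

lemma is_tps_lagrange_exists:
  assumes "n \<ge> 1"
  shows "\<exists>f. is_tps_lagrange n j f"
proof -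
  let ?h = "1 / real n"
  define M where "M i k =
    (if i \<le> n then if k \<le> n then tps (real i * ?h - ?h * real k) else if k = Suc n then 1 else real i * ?h
     else if i = Suc n then if k \<le> n then 1 else 0
     else if k \<le> n then real k else 0)" for i k
  have split: "(\<Sum>k<Suc (Suc (Suc n)). g k) = (\<Sum>k=0..n. g k) + g (Suc n) + g (Suc (Suc n))"
    for g :: "nat \<Rightarrow> real"
    by (simp add: atLeast0AtMost lessThan_Suc_atMost)
  have rows: "i \<le> n \<Longrightarrow> (\<Sum>k<Suc (Suc (Suc n)). M i k * v k) =
        tps_expansion n v (v (Suc n)) (v (Suc (Suc n))) (real i * ?h)"
      "(\<Sum>k<Suc (Suc (Suc n)). M (Suc n) k * v k) = (\<Sum>k=0..n. v k)"
      "(\<Sum>k<Suc (Suc (Suc n)). M (Suc (Suc n)) k * v k) = (\<Sum>k=0..n. real k * v k)" for v i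
    unfolding split by (auto simp: M_def tps_expansion_def mult_ac)
  \<comment> \<open>The index \<open>j\<close> is arbitrary. The guard on \<open>i\<close> keeps the
    right-hand sides of the two side conditions at 0 even if \<open>j\<close> is
    \<open>Suc n\<close> or \<open>Suc (Suc n)\<close>.\<close>
  obtain v where v: "\<And>i. i < Suc (Suc (Suc n)) \<Longrightarrow>
      (\<Sum>k<Suc (Suc (Suc n)). M i k * v k) = (if i = j \<and> i \<le> n then 1 else 0)"
  proof (rule square_linear_system_solvable[where N = "Suc (Suc (Suc n))" and M = M
        and w = "\<lambda>i. if i = j \<and> i \<le> n then 1 else 0"])
    fix v assume v: "\<And>i. i < Suc (Suc (Suc n)) \<Longrightarrow> (\<Sum>k<Suc (Suc (Suc n)). M i k * v k) = 0"
    have "(\<Sum>k=0..n. v k) = 0" "(\<Sum>k=0..n. real k * v k) = 0"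
      using v[of "Suc n"] v[of "Suc (Suc n)"] unfolding rows by simp_all
    moreover have "tps_expansion n v (v (Suc n)) (v (Suc (Suc n))) (real i * ?h) = 0" if "i \<le> n" for i
      using v[of i] rows(1)[OF that] that by simp
    ultimately have "\<forall>k\<le>n. v k = 0" "v (Suc n) = 0" "v (Suc (Suc n)) = 0"
      using tps_expansion_unisolvent[OF assms] by blast+
    then show "\<forall>j<Suc (Suc (Suc n)). v j = 0"
      by (auto simp: less_Suc_eq)
  qed blast
  have "tps_expansion n v (v (Suc n)) (v (Suc (Suc n))) \<in> tps_space n"
    using v[of "Suc n"] v[of "Suc (Suc n)"] unfolding rows by (intro tps_spaceI) simp_all
  moreover have "tps_expansion n v (v (Suc n)) (v (Suc (Suc n))) (real i * ?h) = (if i = j then 1 else 0)"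
    if "i \<le> n" for i
    using v[of i] rows(1)[OF that] that by simp
  ultimately have "is_tps_lagrange n j (tps_expansion n v (v (Suc n)) (v (Suc (Suc n))))"
    by (simp add: is_tps_lagrange_iff)
  then show ?thesis
    by blast
qed

lemma is_tps_lagrange_tps_lagrange:
  assumes "n \<ge> 1"
  shows "is_tps_lagrange n j (tps_lagrange n j)"
  unfolding tps_lagrange_def
proof (rule theI'[of "is_tps_lagrange n j"])
  have "f = g" if "is_tps_lagrange n j f" "is_tps_lagrange n j g" for f g
    using tps_space_eqI[OF assms, of f g] that by (simp add: is_tps_lagrange_iff)
  then show "\<exists>!f. is_tps_lagrange n j f"
    using is_tps_lagrange_exists[OF assms, of j] by blast
qed

text \<open>An affine function lies in the spline space and is therefore its own interpolant. The
  choices (1, 0) and (0, 1) for \<open>b0\<close> and \<open>b1\<close> yield the two moment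
  conditions of the error functional.\<close>

lemma tps_lagrange_reproduces_affine:
  assumes "n \<ge> 1"
  shows "(\<Sum>j=0..n. (b0 + b1 * (real j * (1 / real n))) * tps_lagrange n j x) = b0 + b1 * x"
proof -
  let ?g = "\<lambda>x. b0 + b1 * x"
  have L: "tps_lagrange n j \<in> tps_space n"
      "i \<le> n \<Longrightarrow> tps_lagrange n j (real i * (1 / real n)) = (if i = j then 1 else 0)" for i j
    using is_tps_lagrange_tps_lagrange[OF assms, of j] by (simp_all add: is_tps_lagrange_iff)
  have "(\<lambda>x. \<Sum>j=0..n. ?g (real j * (1 / real n)) * tps_lagrange n j x) = ?g"
  proof (rule tps_space_eqI[OF assms sum_in_tps_space affine_in_tps_space])
    fix i assume "i \<le> n"
    then show "(\<Sum>j=0..n. ?g (real j * (1 / real n)) * tps_lagrange n j (real i * (1 / real n))) = ?g (real i * (1 / real n))"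
      unfolding L(2)[OF \<open>i \<le> n\<close>] by (simp add: if_distrib cong: if_cong)
  qed (rule L)
  then show ?thesis
    by (rule fun_cong)
qed

section \<open>The Fourier transform of the absolute cube\<close>

lemma integrable_continuous_bounded_support:
  fixes h :: "real \<Rightarrow> complex"
  assumes "continuous_on UNIV h" "\<And>t. M < \<bar>t\<bar> \<Longrightarrow> h t = 0"
  shows "integrable lborel h"
proof -
  have "integrable lborel (\<lambda>t. indicator {-M..M} t *\<^sub>R h t)"
    using assms by (intro borel_integrable_compact continuous_on_subset[OF assms(1)]) auto
  moreover have "(\<lambda>t. indicator {-M..M} t *\<^sub>R h t) = h"
    using assms(2) by (force simp: fun_eq_iff indicator_def)
  ultimately show ?thesis
    by simp
qed

text \<open>Over a compact interval the transform becomes a gauge integral, to which the Leibniz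
  rule for differentiation under the integral applies.\<close>

lemma fourier_eq_integral:
  assumes "continuous_on UNIV h" "\<And>t. M < \<bar>t\<bar> \<Longrightarrow> h t = 0"
  shows "fourier h x = integral (cbox (-M) M) (\<lambda>t. exp (- (\<i> * complex_of_real (t * x))) * h t)"
proof -
  let ?f = "\<lambda>t. exp (- (\<i> * complex_of_real (t * x))) * h t"
  have "set_integrable lborel {-M..M} ?f"
    unfolding set_integrable_def
    by (intro borel_integrable_compact continuous_intros continuous_on_subset[OF assms(1)]) auto
  moreover have "(\<lambda>t. indicator {-M..M} t *\<^sub>R ?f t) = ?f"
    using assms(2) by (force simp: fun_eq_iff indicator_def)
  ultimately show ?thesis
    using set_borel_integral_eq_integral(2)[of "{-M..M}" ?f]
    by (simp add: fourier_def set_lebesgue_integral_def)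
qed

lemma integrable_fourier_integrand:
  assumes "continuous_on UNIV h" "\<And>t. M < \<bar>t\<bar> \<Longrightarrow> h t = 0"
  shows "integrable lborel (\<lambda>t. exp (- (\<i> * complex_of_real (t * x))) * h t)"
  by (rule integrable_continuous_bounded_support[where M = M])
    (use assms in \<open>auto intro!: continuous_intros\<close>)

lemma fourier_diff:
  assumes "continuous_on UNIV h" "continuous_on UNIV k"
    "\<And>t. M < \<bar>t\<bar> \<Longrightarrow> h t = 0" "\<And>t. M < \<bar>t\<bar> \<Longrightarrow> k t = 0"
  shows "fourier (\<lambda>t. h t - c * k t) x = fourier h x - c * fourier k x"
proof -
  have "fourier (\<lambda>t. h t - c * k t) x = (LINT t|lborel. exp (- (\<i> * complex_of_real (t * x))) * h t
      - c * (exp (- (\<i> * complex_of_real (t * x))) * k t))"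
    unfolding fourier_def by (intro Bochner_Integration.integral_cong) (auto simp: algebra_simps)
  also have "\<dots> = fourier h x - c * fourier k x"
    unfolding fourier_def
    by (subst Bochner_Integration.integral_diff
        [OF integrable_fourier_integrand[OF assms(1,3)]
          integrable_mult_right[OF integrable_fourier_integrand[OF assms(2,4)]]])
      simp_all
  finally show ?thesis .
qed

lemma norm_fourier_le: "norm (fourier h x) \<le> (LINT t|lborel. norm (h t))"
proof -
  have "norm (fourier h x) \<le> (LINT t|lborel. norm (exp (- (\<i> * complex_of_real (t * x))) * h t))"
    unfolding fourier_def by (rule integral_norm_bound)
  then show ?thesis
    by (simp add: norm_mult)
qed

lemma exp_kernel_has_vector_derivative:
  "((\<lambda>s. exp (- (\<i> * complex_of_real (s * a)))) has_vector_derivative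
     - \<i> * complex_of_real a * exp (- (\<i> * complex_of_real (s * a)))) (at s)"
proof -
  have "((\<lambda>z. exp (- (\<i> * (z * complex_of_real a)))) has_field_derivative
     - \<i> * complex_of_real a * exp (- (\<i> * (complex_of_real s * complex_of_real a)))) (at (complex_of_real s))"
    by (auto intro!: derivative_eq_intros)
  from has_vector_derivative_real_field[OF this] show ?thesis
    by simp
qed

lemma fourier_has_vector_derivative:
  assumes h: "continuous_on UNIV h" "\<And>t. M < \<bar>t\<bar> \<Longrightarrow> h t = 0"
  shows "(fourier h has_vector_derivative - \<i> * fourier (\<lambda>t. complex_of_real t * h t) x) (at x)"
proof -
  let ?f = "\<lambda>x t. exp (- (\<i> * complex_of_real (t * x))) * h t"
  let ?f' = "\<lambda>x t. - \<i> * (exp (- (\<i> * complex_of_real (t * x))) * (complex_of_real t * h t))"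
  have h_comp: "continuous_on S (\<lambda>p. h (g p))" if "continuous_on S g" for S and g :: "real \<times> real \<Rightarrow> real"
    using continuous_on_compose2[OF h(1) that] by simp
  have "((\<lambda>x. integral (cbox (-M) M) (?f x)) has_vector_derivative integral (cbox (-M) M) (?f' x)) (at x within UNIV)"
  proof (rule leibniz_rule_vector_derivative)
    show "((\<lambda>x. ?f x t) has_vector_derivative ?f' x t) (at x within UNIV)" for x t
      using has_vector_derivative_mult_left[OF exp_kernel_has_vector_derivative[of t x], of "h t"]
      by (simp add: mult_ac)
    show "?f x integrable_on cbox (-M) M" for x
      by (intro integrable_continuous continuous_intros continuous_on_subset[OF h(1)]) auto
    show "continuous_on (UNIV \<times> cbox (-M) M) (\<lambda>(x, t). ?f' x t)"
      unfolding split_beta by (intro continuous_intros h_comp)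
  qed auto
  moreover have "integral (cbox (-M) M) (?f' x) = - \<i> * fourier (\<lambda>t. complex_of_real t * h t) x"
    by (subst fourier_eq_integral[where M = M])
      (use h in \<open>auto intro!: continuous_intros simp: simp flip: integral_mult_right\<close>)
  moreover have "fourier h = (\<lambda>x. integral (cbox (-M) M) (?f x))"
    using fourier_eq_integral[OF h] by auto
  ultimately show ?thesis
    by simp
qed

lemma fourier_of_derivative:
  assumes h: "continuous_on UNIV h" "\<And>t. M < \<bar>t\<bar> \<Longrightarrow> h t = 0"
    and h': "continuous_on UNIV h'" "\<And>t. M < \<bar>t\<bar> \<Longrightarrow> h' t = 0"
    and deriv: "\<And>t. (h has_vector_derivative h' t) (at t)"
  shows "fourier h' x = \<i> * complex_of_real x * fourier h x"
proof -
  let ?e = "\<lambda>t. exp (- (\<i> * complex_of_real (t * x)))"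
  \<comment> \<open>This bound exceeds \<open>M\<close> and is positive even for negative
    \<open>M\<close>, so \<open>h\<close> vanishes at both endpoints and the boundary terms
    disappear.\<close>
  let ?B = "\<bar>M\<bar> + 1"
  have d: "((\<lambda>t. ?e t * h t) has_vector_derivative ?e t * h' t - \<i> * complex_of_real x * (?e t * h t)) (at t)" for t
    using has_vector_derivative_mult[OF exp_kernel_has_vector_derivative[of x t] deriv]
    by (simp add: algebra_simps)
  have "(LINT t|lborel. indicator {-?B..?B} t *\<^sub>R (?e t * h' t - \<i> * complex_of_real x * (?e t * h t)))
      = ?e ?B * h ?B - ?e (-?B) * h (-?B)"
    by (rule integral_FTC_Icc)
      (simp, rule has_vector_derivative_at_within[OF d],
        intro continuous_intros continuous_on_subset[OF h(1)] continuous_on_subset[OF h'(1)], auto)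
  also have "\<dots> = 0"
    using h(2)[of ?B] h(2)[of "-?B"] by simp
  also have "(\<lambda>t. indicator {-?B..?B} t *\<^sub>R (?e t * h' t - \<i> * complex_of_real x * (?e t * h t))) =
      (\<lambda>t. ?e t * h' t - \<i> * complex_of_real x * (?e t * h t))"
  proof
    fix t show "indicator {-?B..?B} t *\<^sub>R (?e t * h' t - \<i> * complex_of_real x * (?e t * h t)) =
        ?e t * h' t - \<i> * complex_of_real x * (?e t * h t)"
      using h(2)[of t] h'(2)[of t] by (cases "M < \<bar>t\<bar>") (auto simp: indicator_def)
  qed
  also have "(LINT t|lborel. ?e t * h' t - \<i> * complex_of_real x * (?e t * h t)) =
      fourier h' x - \<i> * complex_of_real x * fourier h x"
    unfolding fourier_def
    by (subst Bochner_Integration.integral_diff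
        [OF integrable_fourier_integrand[OF h']
          integrable_mult_right[OF integrable_fourier_integrand[OF h]]])
      simp_all
  finally show ?thesis
    by simp
qed

text \<open>The complement of the closed support is open and \<open>g\<close> is zero on it, so by
  induction all derivatives vanish there. Since the support is compact and misses 0, one pair of
  radii serves every order.\<close>

lemma test_fun_on_derivatives:
  assumes "test_fun_on (UNIV - {0}) g"
  obtains D :: "nat \<Rightarrow> real \<Rightarrow> complex" and \<epsilon> M where
    "D 0 = g" "\<And>k t. (D k has_vector_derivative D (Suc k) t) (at t)" "0 < \<epsilon>"
    "\<And>k t. \<bar>t\<bar> < \<epsilon> \<Longrightarrow> D k t = 0" "\<And>k t. M < \<bar>t\<bar> \<Longrightarrow> D k t = 0"
proof -
  obtain D :: "nat \<Rightarrow> real \<Rightarrow> complex" where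
    D: "D 0 = g" "\<And>k t. (D k has_vector_derivative D (Suc k) t) (at t)"
    using assms unfolding test_fun_on_def smooth_fun_def by blast
  let ?K = "closure {t. g t \<noteq> 0}"
  have K: "compact ?K" "0 \<notin> ?K"
    using assms unfolding test_fun_on_def by auto
  have zero: "D k t = 0" if "t \<notin> ?K" for k t
    using that
  proof (induction k arbitrary: t)
    case 0
    then show ?case
      using closure_subset[of "{t. g t \<noteq> 0}"] by (auto simp: D)
  next
    case (Suc k)
    have "((\<lambda>_. 0) has_vector_derivative D (Suc k) t) (at t)"
      by (rule has_vector_derivative_transform_within_open[OF D(2), where S = "- ?K"])
        (use Suc in auto)
    then show ?case
      using vector_derivative_unique_at has_vector_derivative_const by metis
  qed
  obtain \<epsilon> where "\<epsilon> > 0" "ball 0 \<epsilon> \<subseteq> - ?K"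
    using K(2) open_contains_ball[of "- ?K"] by auto
  moreover obtain M where "\<forall>t\<in>?K. norm t \<le> M"
    using compact_imp_bounded[OF K(1)] unfolding bounded_iff by blast
  ultimately show ?thesis
    by (intro that[of D \<epsilon> M] D) (force intro!: zero)+
qed

section \<open>Fourier transforms of derivatives divided by powers of the variable\<close>

context
  fixes D :: "nat \<Rightarrow> real \<Rightarrow> complex" and \<epsilon> M :: real
  assumes D: "\<And>k t. (D k has_vector_derivative D (Suc k) t) (at t)"
    and pos: "0 < \<epsilon>"
    and near: "\<And>k t. \<bar>t\<bar> < \<epsilon> \<Longrightarrow> D k t = 0"
    and far: "\<And>k t. M < \<bar>t\<bar> \<Longrightarrow> D k t = 0"
begin

text \<open>The junk value \<open>0 / 0 = 0\<close> at \<open>t = 0\<close> is the right one, since \<open>D k\<close> vanishes near \<open>0\<close>.\<close>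

private definition H :: "nat \<Rightarrow> nat \<Rightarrow> real \<Rightarrow> complex" where
  "H k j t = D k t / complex_of_real t ^ j"

private lemma H_far: "M < \<bar>t\<bar> \<Longrightarrow> H k j t = 0"
  by (simp add: H_def far)

private lemma H_mult: "complex_of_real t * H k (Suc j) t = H k j t"
  using near[of t k] pos by (cases "t = 0") (auto simp: H_def)

private lemma H_derivative:
  "(H k j has_vector_derivative H (Suc k) j t - of_nat j * H k (Suc j) t) (at t)"
proof (cases "t = 0")
  case True
  have "(H k j has_vector_derivative 0) (at t)"
    by (rule has_vector_derivative_transform_within_open[OF has_vector_derivative_const[of 0],
          where S = "ball 0 \<epsilon>"])
      (use True pos near in \<open>auto simp: H_def\<close>)
  then show ?thesis
    using True near[of 0] pos by (simp add: H_def)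
next
  case False
  have "((\<lambda>z. inverse (z ^ j)) has_field_derivative - (of_nat j / complex_of_real t ^ Suc j)) (at (complex_of_real t))"
  proof (cases "j = 0")
    case j: False
    then have "complex_of_real t ^ j = complex_of_real t * complex_of_real t ^ (j - 1)"
      by (simp add: power_eq_if)
    then show ?thesis
      using False j by (auto intro!: derivative_eq_intros simp: power2_eq_square field_simps)
  qed (auto intro!: derivative_eq_intros)
  from has_vector_derivative_mult[OF D has_vector_derivative_real_field[OF this]]
  show ?thesis
    by (simp add: H_def[abs_def] divide_inverse mult_ac)
qed

private lemma H_continuous: "continuous_on UNIV (H k j)"
  using H_derivative by (intro continuous_at_imp_continuous_on ballI) (blast intro: has_vector_derivative_continuous)

text \<open>Multiplication by \<open>i * x\<close> on the Fourier side is differentiation of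
  \<open>H k j\<close>, and the quotient rule stays within the family \<open>H\<close>.\<close>

private lemma fourier_H_shift:
  "\<i> * complex_of_real x * fourier (H k j) x = fourier (H (Suc k) j) x - of_nat j * fourier (H k (Suc j)) x"
proof -
  have "fourier (\<lambda>t. H (Suc k) j t - of_nat j * H k (Suc j) t) x = \<i> * complex_of_real x * fourier (H k j) x"
    by (rule fourier_of_derivative[where M = M, OF H_continuous H_far _ _ H_derivative])
      (auto intro!: continuous_intros H_continuous simp: H_far)
  then show ?thesis
    by (simp add: fourier_diff[where M = M] H_continuous H_far)
qed

text \<open>Each further factor \<open>x\<close> is absorbed by \<open>fourier_H_shift\<close> at
  the price of passing to other members of the family; hence the induction lets \<open>k\<close> and
  \<open>j\<close> vary.\<close>

private lemma fourier_H_decay: "\<exists>C. \<forall>x. \<bar>x\<bar> ^ m * norm (fourier (H k j) x) \<le> C"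
proof (induction m arbitrary: k j)
  case 0
  show ?case
    using norm_fourier_le by auto
next
  case (Suc m)
  obtain C1 C2 where C: "\<And>x. \<bar>x\<bar> ^ m * norm (fourier (H (Suc k) j) x) \<le> C1"
      "\<And>x. \<bar>x\<bar> ^ m * norm (fourier (H k (Suc j)) x) \<le> C2"
    using Suc by meson
  have "\<bar>x\<bar> ^ Suc m * norm (fourier (H k j) x) \<le> C1 + real j * C2" for x
  proof -
    have "\<bar>x\<bar> ^ Suc m * norm (fourier (H k j) x) = \<bar>x\<bar> ^ m * norm (\<i> * complex_of_real x * fourier (H k j) x)"
      by (simp add: norm_mult)
    also have "\<dots> \<le> \<bar>x\<bar> ^ m * (norm (fourier (H (Suc k) j) x) + real j * norm (fourier (H k (Suc j)) x))"
      unfolding fourier_H_shift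
      by (intro mult_left_mono order_trans[OF norm_triangle_ineq4]) (auto simp: norm_mult)
    also have "\<dots> = \<bar>x\<bar> ^ m * norm (fourier (H (Suc k) j) x) + real j * (\<bar>x\<bar> ^ m * norm (fourier (H k (Suc j)) x))"
      by (simp add: algebra_simps)
    also have "\<dots> \<le> C1 + real j * C2"
      by (intro add_mono mult_left_mono C) auto
    finally show ?thesis .
  qed
  then show ?case
    by blast
qed

private lemma fourier_H_derivative:
  "(fourier (H k (Suc j)) has_vector_derivative - \<i> * fourier (H k j) x) (at x)"
  using fourier_has_vector_derivative[where M = M, OF H_continuous H_far, of k "Suc j" x]
  by (simp add: H_mult)

private lemma fourier_H_continuous: "isCont (fourier (H k j)) x"
  using fourier_has_vector_derivative[where M = M, OF H_continuous H_far]
  by (rule has_vector_derivative_continuous)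

private lemma fourier_H_tendsto_0:
  assumes "filterlim (\<lambda>x::real. \<bar>x\<bar>) at_top F"
  shows "((\<lambda>x. complex_of_real x ^ m * fourier (H k j) x) \<longlongrightarrow> 0) F"
proof -
  obtain C where C: "\<And>x. \<bar>x\<bar> ^ Suc m * norm (fourier (H k j) x) \<le> C"
    using fourier_H_decay by blast
  show ?thesis
  proof (rule Lim_null_comparison)
    show "eventually (\<lambda>x. norm (complex_of_real x ^ m * fourier (H k j) x) \<le> C / \<bar>x\<bar>) F"
      using filterlim_at_top_dense[THEN iffD1, OF assms, rule_format, of 0]
    proof eventually_elim
      case (elim x)
      then show ?case
        using C[of x] by (simp add: norm_mult norm_power field_simps)
    qed
    show "((\<lambda>x. C / \<bar>x\<bar>) \<longlongrightarrow> 0) F"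
      by (intro tendsto_divide_0[OF tendsto_const] filterlim_at_top_imp_at_infinity assms)
  qed
qed

private lemma integrable_cube_fourier: "integrable lborel (\<lambda>x. complex_of_real (\<bar>x\<bar> ^ 3) * fourier (H k j) x)"
proof -
  \<comment> \<open>Exponent 3 bounds the integrand on [-1,1]; exponent 5 leaves the decay
    \<open>x^(-2)\<close> outside.\<close>
  obtain C3 C5 where C: "\<And>x. \<bar>x\<bar> ^ 3 * norm (fourier (H k j) x) \<le> C3"
      "\<And>x. \<bar>x\<bar> ^ 5 * norm (fourier (H k j) x) \<le> C5"
    using fourier_H_decay[of 3 k j] fourier_H_decay[of 5 k j] by blast
  let ?f = "\<lambda>x. complex_of_real (\<bar>x\<bar> ^ 3) * fourier (H k j) x"
  have "continuous_on UNIV ?f"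
    using fourier_H_continuous by (intro continuous_intros continuous_at_imp_continuous_on) auto
  then have meas: "?f \<in> borel_measurable borel"
    by (rule borel_measurable_continuous_onI)
  have "integrable lborel (\<lambda>x. norm (?f x))"
  proof (rule integrable_le_inverse_1_plus_square[where C = "max C3 C5"])
    show "\<bar>norm (?f x)\<bar> \<le> max C3 C5" for x
      using C(1)[of x] by (simp add: norm_mult norm_power)
    show "\<bar>norm (?f x)\<bar> \<le> max C3 C5 / x\<^sup>2" if "1 < \<bar>x\<bar>" for x
    proof -
      have "norm (?f x) * x\<^sup>2 = \<bar>x\<bar> ^ 5 * norm (fourier (H k j) x)"
        by (simp add: norm_mult norm_power eval_nat_numeral abs_mult_self_eq mult_ac)
      then show ?thesis
        using C(2)[of x] that by (simp add: field_simps)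
    qed
  qed (rule measurable_compose[OF meas borel_measurable_norm])
  then show ?thesis
    using meas by (subst (asm) integrable_norm_iff) auto
qed

text \<open>Since (-i)^4 = 1, the transform of \<open>D 0\<close> is the fourth derivative of the
  transform of \<open>D 0 t / t^4\<close>. On the positive half-line the primitive of the integrand
  is \<open>G\<close>, on the negative one it is \<open>- G\<close>, because there
  \<open>|x|^3 = - x^3\<close>. Each half contributes \<open>- G 0\<close>, which is 6 times the
  transform of \<open>D 0 t / t^4\<close> at 0.\<close>

lemma fourier_abs_cube:
  "(LINT x|lborel. complex_of_real (\<bar>x\<bar> ^ 3) * fourier (D 0) x) =
    12 * (LINT t|lborel. D 0 t / complex_of_real t ^ 4)"
proof -
  let ?F = "\<lambda>j. fourier (H 0 j)"
  let ?f = "\<lambda>x. complex_of_real (\<bar>x\<bar> ^ 3) * ?F 0 x"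
  \<comment> \<open>\<open>G\<close> is the primitive of \<open>x\<^sup>3 F\<^sub>0\<close> that integration by parts yields from \<open>F\<^sub>j\<^sub>+\<^sub>1' = - \<i> F\<^sub>j\<close>.\<close>
  define G where "G x = \<i> * (complex_of_real x ^ 3 * ?F 1 x) + 3 * (complex_of_real x ^ 2 * ?F 2 x)
      - 6 * \<i> * (complex_of_real x ^ 1 * ?F 3 x) - 6 * (complex_of_real x ^ 0 * ?F 4 x)" for x
  have F': "(?F 1 has_vector_derivative - \<i> * ?F 0 x) (at x)" "(?F 2 has_vector_derivative - \<i> * ?F 1 x) (at x)"
      "(?F 3 has_vector_derivative - \<i> * ?F 2 x) (at x)" "(?F 4 has_vector_derivative - \<i> * ?F 3 x) (at x)" for x
    using fourier_H_derivative[of 0 _ x] by (auto simp: eval_nat_numeral)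
  have pow: "((\<lambda>x. complex_of_real x ^ m) has_vector_derivative of_nat m * complex_of_real x ^ (m - 1)) (at x)" for m x
    by (rule has_vector_derivative_real_field) (auto intro!: derivative_eq_intros)
  have G': "(G has_vector_derivative complex_of_real (x ^ 3) * ?F 0 x) (at x)" for x
    unfolding G_def
    by (rule has_vector_derivative_eq_rhs, (rule derivative_intros pow F')+)
      (simp add: algebra_simps power2_eq_square power3_eq_cube)
  have G_lim: "(G \<longlongrightarrow> 0) F" if "filterlim (\<lambda>x::real. \<bar>x\<bar>) at_top F" for F
    unfolding G_def by (rule tendsto_eq_intros fourier_H_tendsto_0[OF that] refl)+ simp
  have abs_at_bot: "filterlim (\<lambda>x::real. \<bar>x\<bar>) at_top at_bot"
    by (auto simp: filterlim_at_bot_mirror filterlim_abs_real)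
  have G_cont: "isCont G x" for x
    using G' by (rule has_vector_derivative_continuous)
  have f_cont: "isCont ?f x" for x
    using fourier_H_continuous by (intro continuous_intros) auto
  have f_int: "set_integrable lborel A ?f" if "A \<in> sets borel" for A
    using integrable_cube_fourier that unfolding set_integrable_def
    by (intro integrable_mult_indicator) auto
  have "(LBINT x=0..\<infinity>. ?f x) = 0 - G 0"
  proof (rule interval_integral_FTC_integrable)
    show "(G has_vector_derivative ?f x) (at x)" if "0 < ereal x" for x
      using G'[of x] that by simp
    show "((G \<circ> real_of_ereal) \<longlongrightarrow> 0) (at_left \<infinity>)"
      by (auto simp: ereal_tendsto_simps intro!: G_lim filterlim_abs_real)
    show "((G \<circ> real_of_ereal) \<longlongrightarrow> G 0) (at_right 0)"
      using G_cont[of 0] unfolding zero_ereal_def ereal_tendsto_simps isCont_def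
      by (rule filterlim_mono) (auto simp: at_within_le_at)
  qed (simp, rule f_cont, rule f_int, simp)
  moreover have "(LBINT x=-\<infinity>..0. ?f x) = - G 0 - 0"
  proof (rule interval_integral_FTC_integrable)
    show "((\<lambda>x. - G x) has_vector_derivative ?f x) (at x)" if "ereal x < 0" for x
      using has_vector_derivative_minus[OF G'[of x]] that by simp
    show "(((\<lambda>x. - G x) \<circ> real_of_ereal) \<longlongrightarrow> 0) (at_right (- \<infinity>))"
      unfolding ereal_tendsto_simps
      using tendsto_minus[OF G_lim[OF abs_at_bot]] by simp
    show "(((\<lambda>x. - G x) \<circ> real_of_ereal) \<longlongrightarrow> - G 0) (at_left 0)"
      using tendsto_minus[OF G_cont[of 0, unfolded isCont_def]] unfolding zero_ereal_def ereal_tendsto_simps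
      by (rule filterlim_mono) (auto simp: at_within_le_at)
  qed (simp, rule f_cont, rule f_int, simp)
  moreover have "(LBINT x=-\<infinity>..0. ?f x) + (LBINT x=0..\<infinity>. ?f x) = (LBINT x=-\<infinity>..\<infinity>. ?f x)"
    using f_int[of UNIV] by (intro interval_integral_sum) (simp add: interval_lebesgue_integrable_def)
  ultimately have "(LINT x|lborel. ?f x) = - 2 * G 0"
    by (simp add: interval_lebesgue_integral_def set_lebesgue_integral_def)
  also have "\<dots> = 12 * ?F 4 0"
    by (simp add: G_def)
  finally show ?thesis
    by (simp add: H_def[abs_def] fourier_def)
qed

end

lemma gen_fourier_abs_cube:
  "gen_fourier_eq_on (UNIV - {0}) (\<lambda>x. complex_of_real (\<bar>x\<bar> ^ 3)) (\<lambda>t. complex_of_real (12 / \<bar>t\<bar> ^ 4))"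
  unfolding gen_fourier_eq_on_def
proof (intro allI impI)
  fix g assume "test_fun_on (UNIV - {0}) g"
  then obtain D :: "nat \<Rightarrow> real \<Rightarrow> complex" and \<epsilon> M where
    D: "D 0 = g" "\<And>k t. (D k has_vector_derivative D (Suc k) t) (at t)" "0 < \<epsilon>"
    "\<And>k t. \<bar>t\<bar> < \<epsilon> \<Longrightarrow> D k t = 0" "\<And>k t. M < \<bar>t\<bar> \<Longrightarrow> D k t = 0"
    by (rule test_fun_on_derivatives) (rule that; assumption)
  have "(LINT x|lborel. complex_of_real (\<bar>x\<bar> ^ 3) * fourier g x) = 12 * (LINT t|lborel. g t / complex_of_real t ^ 4)"
    using fourier_abs_cube[of D \<epsilon> M] D by simp
  also have "\<dots> = (LINT t|lborel. complex_of_real (12 / \<bar>t\<bar> ^ 4) * g t)"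
    by (simp flip: integral_mult_right_zero add: mult_ac)
  finally show "(LINT x|lborel. complex_of_real (\<bar>x\<bar> ^ 3) * fourier g x) =
      (LINT t|lborel. complex_of_real (12 / \<bar>t\<bar> ^ 4) * g t)" .
qed

section \<open>A bump function and the value of \<open>A3\<close>\<close>

lemma poly_div_exp_tendsto_0: "((\<lambda>y. poly p y / exp y) \<longlongrightarrow> (0 :: real)) at_top"
proof -
  have "((\<lambda>y. \<Sum>i\<le>degree p. coeff p i * (y ^ i / exp y)) \<longlongrightarrow> (\<Sum>i\<le>degree p. coeff p i * (0 :: real))) at_top"
    by (intro tendsto_sum tendsto_mult tendsto_const tendsto_power_div_exp_0)
  then show ?thesis
    by (simp add: poly_altdef sum_divide_distrib)
qed

text \<open>The polynomial in \<open>1 / t\<close> makes the family closed under differentiation,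
  which the flat function exp(-1/t) alone is not.\<close>

definition flat_exp :: "real poly \<Rightarrow> real \<Rightarrow> real" where
  "flat_exp p t = (if 0 < t then poly p (1 / t) / exp (1 / t) else 0)"

text \<open>With s = 1/t one has ds/dt = -s^2, so p(s) exp(-s) has the derivative s^2 (p(s) - p'(s))
  exp(-s); the list polynomial is s^2.\<close>

definition flat_step :: "real poly \<Rightarrow> real poly" where
  "flat_step p = [:0, 0, 1:] * (p - pderiv p)"

lemma flat_exp_derivative: "(flat_exp p has_real_derivative flat_exp (flat_step p) t) (at t)"
proof -
  consider "t < 0" | "t = 0" | "0 < t"
    by linarith
  then show ?thesis
  proof cases
    case 1
    have "((\<lambda>_. 0) has_real_derivative 0) (at t)"
      by simp
    then have "(flat_exp p has_real_derivative 0) (at t)"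
      by (rule has_field_derivative_transform_within_open[where S = "{..<0}"])
        (use 1 in \<open>auto simp: flat_exp_def\<close>)
    then show ?thesis
      using 1 by (simp add: flat_exp_def)
  next
    case 2
    have "((\<lambda>h. flat_exp p h / h) \<longlongrightarrow> 0) (at_left 0)"
      by (rule tendsto_eventually) (auto simp: eventually_at_filter flat_exp_def)
    \<comment> \<open>In the variable y = 1/h the division by \<open>h\<close> is one more factor y,
      which is what \<open>pCons 0 p\<close> supplies; the exponential still dominates.\<close>
    moreover have "((\<lambda>h. flat_exp p h / h) \<longlongrightarrow> 0) (at_right 0)"
    proof (rule Lim_transform_eventually)
      show "((\<lambda>h. poly (pCons 0 p) (inverse h) / exp (inverse h)) \<longlongrightarrow> 0) (at_right 0)"
        by (rule filterlim_compose[OF poly_div_exp_tendsto_0 filterlim_inverse_at_top_right])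
      show "\<forall>\<^sub>F h in at_right 0. poly (pCons 0 p) (inverse h) / exp (inverse h) = flat_exp p h / h"
        by (auto simp: eventually_at_filter flat_exp_def field_simps)
    qed
    ultimately show ?thesis
      using 2 by (auto simp: has_field_derivative_iff flat_exp_def intro: filterlim_split_at)
  next
    case 3
    have "((\<lambda>t. poly p (1 / t) / exp (1 / t)) has_real_derivative
        poly (flat_step p) (1 / t) / exp (1 / t)) (at t)"
      using 3 by (auto intro!: derivative_eq_intros simp: flat_step_def field_simps power2_eq_square)
    then have "(flat_exp p has_real_derivative poly (flat_step p) (1 / t) / exp (1 / t)) (at t)"
      by (rule has_field_derivative_transform_within_open[where S = "{0<..}"])
        (use 3 in \<open>auto simp: flat_exp_def\<close>)
    then show ?thesis
      using 3 by (simp add: flat_exp_def)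
  qed
qed

text \<open>A list of pairs encodes a sum of products of flat exponentials; such sums, unlike the bump
  itself, are closed under differentiation.\<close>

definition bump_sum :: "(real poly \<times> real poly) list \<Rightarrow> real \<Rightarrow> real" where
  "bump_sum xs t = (\<Sum>(p, q)\<leftarrow>xs. flat_exp p (t - 1) * flat_exp q (2 - t))"

text \<open>The product rule turns one pair into two; the minus sign is the inner derivative of
  \<open>2 - t\<close>, stored in the first polynomial.\<close>

definition bump_step :: "(real poly \<times> real poly) list \<Rightarrow> (real poly \<times> real poly) list" where
  "bump_step xs = concat (map (\<lambda>(p, q). [(flat_step p, q), (- p, flat_step q)]) xs)"

lemma bump_sum_derivative: "(bump_sum xs has_real_derivative bump_sum (bump_step xs) t) (at t)"
proof (induction xs)
  case Nil
  then show ?case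
    by (simp add: bump_sum_def[abs_def] bump_step_def)
next
  case (Cons x xs)
  obtain p q where x: "x = (p, q)"
    by force
  have "((\<lambda>t. flat_exp p (t - 1)) has_real_derivative flat_exp (flat_step p) (t - 1) * 1) (at t)"
    by (rule DERIV_chain2[OF flat_exp_derivative]) (auto intro!: derivative_eq_intros)
  moreover have "((\<lambda>t. flat_exp q (2 - t)) has_real_derivative flat_exp (flat_step q) (2 - t) * (- 1)) (at t)"
    by (rule DERIV_chain2[OF flat_exp_derivative]) (auto intro!: derivative_eq_intros)
  ultimately have "((\<lambda>t. flat_exp p (t - 1) * flat_exp q (2 - t) + bump_sum xs t) has_real_derivative
      flat_exp (flat_step p) (t - 1) * 1 * flat_exp q (2 - t) + flat_exp (flat_step q) (2 - t) * (- 1) * flat_exp p (t - 1)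
      + bump_sum (bump_step xs) t) (at t)"
    by (intro DERIV_add DERIV_mult Cons.IH)
  moreover have "flat_exp (- p) s = - flat_exp p s" for s
    by (simp add: flat_exp_def)
  ultimately show ?case
    by (simp add: x bump_sum_def[abs_def] bump_step_def algebra_simps)
qed

definition bump :: "real \<Rightarrow> real" where
  "bump t = flat_exp 1 (t - 1) * flat_exp 1 (2 - t)"

lemma bump_eq_bump_sum: "bump = bump_sum [(1, 1)]"
  by (simp add: bump_def bump_sum_def fun_eq_iff)

lemma bump_nonneg: "0 \<le> bump t"
  by (simp add: bump_def flat_exp_def)

lemma bump_eq_0_iff: "bump t = 0 \<longleftrightarrow> \<not> (1 < t \<and> t < 2)"
  by (simp add: bump_def flat_exp_def)

lemma test_fun_on_bump: "test_fun_on (UNIV - {0}) (\<lambda>t. complex_of_real (bump t))"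
proof -
  have "smooth_fun (\<lambda>t. complex_of_real (bump t))"
    unfolding smooth_fun_def
  proof (intro exI conjI allI)
    let ?D = "\<lambda>k t. complex_of_real (bump_sum ((bump_step ^^ k) [(1, 1)]) t)"
    show "?D 0 = (\<lambda>t. complex_of_real (bump t))"
      by (simp add: bump_eq_bump_sum)
    show "(?D k has_vector_derivative ?D (Suc k) t) (at t)" for k t
      using has_vector_derivative_of_real[OF bump_sum_derivative] by simp
  qed
  moreover have "{t. complex_of_real (bump t) \<noteq> 0} = {1<..<2}"
    by (auto simp: bump_eq_0_iff)
  ultimately show ?thesis
    by (auto simp: test_fun_on_def)
qed

lemma bump_integral_nonzero: "(LINT t|lborel. complex_of_real (bump t) / complex_of_real (\<bar>t\<bar> ^ 4)) \<noteq> 0"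
proof
  let ?f = "\<lambda>t. bump t / \<bar>t\<bar> ^ 4"
  \<comment> \<open>Where the bump is nonzero, \<open>t\<close> exceeds 1, so the denominator may be
    replaced by one that never vanishes, and continuity holds at 0 too.\<close>
  have eq: "complex_of_real (?f t) = complex_of_real (bump t / (max 1 t) ^ 4)" for t
    using bump_eq_0_iff[of t] by (cases "1 < t") simp_all
  have "isCont bump t" for t
    unfolding bump_eq_bump_sum using bump_sum_derivative by (rule DERIV_isCont)
  then have "continuous_on UNIV (\<lambda>t. complex_of_real (?f t))"
    unfolding eq by (intro continuous_intros continuous_at_imp_continuous_on) auto
  then have "integrable lborel (\<lambda>t. complex_of_real (?f t))"
    by (rule integrable_continuous_bounded_support[where M = 2]) (auto simp: bump_eq_0_iff)
  then have int: "integrable lborel ?f"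
    by (simp only: complex_of_real_integrable_eq)
  assume "(LINT t|lborel. complex_of_real (bump t) / complex_of_real (\<bar>t\<bar> ^ 4)) = 0"
  then have "(LINT t|lborel. complex_of_real (?f t)) = 0"
    by simp
  then have "(LINT t|lborel. ?f t) = 0"
    by (simp only: integral_complex_of_real of_real_eq_0_iff)
  then have "AE t in lborel. ?f t = 0"
    using integral_nonneg_eq_0_iff_AE[OF int] bump_nonneg by simp
  then have "AE t in lborel. t \<notin> {1<..<2::real}"
  proof eventually_elim
    case (elim t)
    then show ?case
      by (auto simp: bump_eq_0_iff)
  qed
  then have "{1<..<2::real} \<in> null_sets lborel"
    by (subst AE_iff_null_sets) auto
  then show False
    by (simp add: null_sets_def)
qed

text \<open>Testing two admissible constants against the bump gives the same multiple of one nonzero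
  integral, so the constant in the definite description is unique.\<close>

lemma A3_eq: "A3 = 12"
  unfolding A3_def
proof (rule the_equality)
  let ?F = "\<lambda>A t. complex_of_real (A / \<bar>t\<bar> ^ 4)"
  show "gen_fourier_eq_on (UNIV - {0}) (\<lambda>x. complex_of_real (\<bar>x\<bar> ^ 3)) (?F 12)"
    by (rule gen_fourier_abs_cube)
  fix A
  assume A: "gen_fourier_eq_on (UNIV - {0}) (\<lambda>x. complex_of_real (\<bar>x\<bar> ^ 3)) (?F A)"
  let ?I = "LINT t|lborel. complex_of_real (bump t) / complex_of_real (\<bar>t\<bar> ^ 4)"
  have scale: "(LINT t|lborel. ?F B t * complex_of_real (bump t)) = complex_of_real B * ?I" for B
    by (subst Bochner_Integration.integral_mult_right_zero[symmetric])
      (intro Bochner_Integration.integral_cong, auto)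
  have "(LINT t|lborel. ?F A t * complex_of_real (bump t)) = (LINT t|lborel. ?F 12 t * complex_of_real (bump t))"
    using A[unfolded gen_fourier_eq_on_def, rule_format, OF test_fun_on_bump]
      gen_fourier_abs_cube[unfolded gen_fourier_eq_on_def, rule_format, OF test_fun_on_bump]
    by (rule trans[OF sym])
  then have "complex_of_real A = complex_of_real 12"
    unfolding scale using bump_integral_nonzero by (simp only: mult_cancel_right) blast
  then show "A = 12"
    by (simp only: of_real_eq_iff)
qed

section \<open>The Peano kernel\<close>

text \<open>By symmetry let \<open>y\<close> be the smaller node; the product then lives on [0,y]
  and is a quadratic polynomial there. The value is split so that every monomial apart from the
  cubed distance has degree at most 1 in \<open>y\<close> or in \<open>z\<close>, as the moment
  conditions require for cancellation.\<close>

lemma has_bochner_integral_truncated_product: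
  fixes y z :: real
  assumes "y \<in> {0..1}" "z \<in> {0..1}"
  shows "has_bochner_integral lborel (\<lambda>u. indicator {0..1} u * (max (y - u) 0 * max (z - u) 0))
    (\<bar>y - z\<bar> ^ 3 / 12 + (y * z * (y + z) / 4 - (y ^ 3 + z ^ 3) / 12))"
  using assms
proof (induction y z rule: linorder_wlog)
  case (le y z)
  let ?F = "\<lambda>u. y * z * u - (y + z) * u\<^sup>2 / 2 + u ^ 3 / 3"
  have "has_bochner_integral lborel (\<lambda>u. (y - u) * (z - u) * indicator {0..y} u) (?F y - ?F 0)"
    by (rule has_bochner_integral_FTC_Icc_real)
      (use le in \<open>auto intro!: derivative_eq_intros simp: field_simps power2_eq_square\<close>)
  moreover have "?F y - ?F 0 = \<bar>y - z\<bar> ^ 3 / 12 + (y * z * (y + z) / 4 - (y ^ 3 + z ^ 3) / 12)"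
    using le(1) by (simp add: abs_if field_simps power2_eq_square power3_eq_cube)
  moreover have "(y - u) * (z - u) * indicator {0..y} u =
      indicator {0..1} u * (max (y - u) 0 * max (z - u) 0)" for u
    using le by (auto simp: indicator_def max_def)
  ultimately show ?case
    by simp
next
  case (sym z y)
  then show ?case
    by (simp add: abs_minus_commute mult_ac add_ac)
qed

lemma has_bochner_integral_truncated_sum_squared:
  fixes c y :: "'i \<Rightarrow> real"
  assumes c: "(\<Sum>i\<in>I. c i) = 0" "(\<Sum>i\<in>I. c i * y i) = 0" and y: "\<And>i. i \<in> I \<Longrightarrow> y i \<in> {0..1}"
  shows "has_bochner_integral lborel (\<lambda>u. indicator {0..1} u * (\<Sum>i\<in>I. c i * max (y i - u) 0)\<^sup>2)
    ((\<Sum>i\<in>I. \<Sum>j\<in>I. c i * c j * \<bar>y i - y j\<bar> ^ 3) / 12)"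
proof -
  let ?r = "\<lambda>a b :: real. a * b * (a + b) / 4 - (a ^ 3 + b ^ 3) / 12"
  have "has_bochner_integral lborel
      (\<lambda>u. \<Sum>i\<in>I. \<Sum>j\<in>I. c i * c j * (indicator {0..1} u * (max (y i - u) 0 * max (y j - u) 0)))
      (\<Sum>i\<in>I. \<Sum>j\<in>I. c i * c j * (\<bar>y i - y j\<bar> ^ 3 / 12 + ?r (y i) (y j)))"
    by (intro has_bochner_integral_sum has_bochner_integral_mult_right
        has_bochner_integral_truncated_product y)
  moreover have "(\<Sum>i\<in>I. \<Sum>j\<in>I. c i * c j * (indicator {0..1} u * (max (y i - u) 0 * max (y j - u) 0))) =
      indicator {0..1} u * (\<Sum>i\<in>I. c i * max (y i - u) 0)\<^sup>2" for u
    by (simp add: power2_eq_square sum_product sum_distrib_left mult_ac)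
  moreover have "(\<Sum>i\<in>I. \<Sum>j\<in>I. c i * c j * (\<bar>y i - y j\<bar> ^ 3 / 12 + ?r (y i) (y j))) =
      (\<Sum>i\<in>I. \<Sum>j\<in>I. c i * c j * \<bar>y i - y j\<bar> ^ 3) / 12"
  proof -
    \<comment> \<open>Each remainder term is arranged as a function of \<open>i\<close> times a
      function of \<open>j\<close>, one of them being \<open>c\<close> or \<open>c * y\<close>, so
      that its double sum is a product with a zero factor.\<close>
    have "c i * c j * (\<bar>y i - y j\<bar> ^ 3 / 12 + ?r (y i) (y j)) = c i * c j * \<bar>y i - y j\<bar> ^ 3 / 12
        + ((c i * (y i)\<^sup>2) * (c j * y j) / 4 + (c i * y i) * (c j * (y j)\<^sup>2) / 4
        - ((c i * (y i) ^ 3) * c j / 12 + c i * (c j * (y j) ^ 3) / 12))" for i j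
      by (simp add: field_simps power2_eq_square power3_eq_cube)
    then show ?thesis
      by (simp add: sum.distrib sum_subtractf c flip: sum_divide_distrib sum_product)
  qed
  ultimately show ?thesis
    by simp
qed

theorem proposition4p1:
  shows "\<exists>C::real. C > 0 \<and>
    (\<forall>n::nat. n \<ge> 1 \<longrightarrow> (\<forall>x\<in>{0..1::real}.
       mixed_power n x = C * sqrt (LBINT u:{0..1}. \<bar>peano_kernel n x u\<bar>^2)))"
proof (intro exI conjI allI impI ballI)
  \<comment> \<open>The squared mixed power is
    \<open>12 / (2 * pi) * cos_quartic_integral * Q\<close> and the squared kernel norm is
    \<open>Q / 12\<close>; the quotient is the number under this root.\<close>
  let ?C = "sqrt (72 * cos_quartic_integral / pi)"
  show "?C > 0"
    using cos_quartic_integral_pos by simp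
  fix n :: nat and x :: real
  assume n: "n \<ge> 1" and x: "x \<in> {0..1}"
  \<comment> \<open>The error functional is encoded as a single weighted sum: indices up to
    \<open>n\<close> are the grid points, and \<open>Suc n\<close> is the evaluation point
    \<open>x\<close> with weight 1.\<close>
  define c where "c i = (if i \<le> n then - tps_lagrange n i x else 1)" for i
  define y where "y i = (if i \<le> n then (1 / real n) * real i else x)" for i
  let ?I = "{0..Suc n}"
  \<comment> \<open>The value type of \<open>f\<close> is left open because the splitting serves the
    complex sum in \<open>Theta\<close> as well as the real sums of the moments and the
    kernel.\<close>
  have split: "(\<Sum>i\<in>?I. f (c i) (y i)) = f 1 x + (\<Sum>j=0..n. f (- tps_lagrange n j x) ((1 / real n) * real j))"
    for f :: "real \<Rightarrow> real \<Rightarrow> 'a :: comm_monoid_add"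
    by (simp add: c_def y_def add.commute)
  have c: "(\<Sum>i\<in>?I. c i) = 0" "(\<Sum>i\<in>?I. c i * y i) = 0"
    using tps_lagrange_reproduces_affine[OF n, of 1 0 x] tps_lagrange_reproduces_affine[OF n, of 0 1 x]
      split[of "\<lambda>a b. a"] split[of "\<lambda>a b. a * b"]
    by (simp_all add: sum_negf mult_ac)
  have y: "y i \<in> {0..1}" for i
    using x n by (auto simp: y_def)
  define Q where "Q = (\<Sum>i\<in>?I. \<Sum>j\<in>?I. c i * c j * \<bar>y i - y j\<bar> ^ 3)"
  have "Theta n x t = (\<Sum>i\<in>?I. complex_of_real (c i) * exp (\<i> * complex_of_real (y i * t)))" for t
    unfolding Theta_def split[of "\<lambda>a b. complex_of_real a * exp (\<i> * complex_of_real (b * t))"]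
    by (simp add: sum_negf)
  then have "(LINT t|lborel. (cmod (Theta n x t))\<^sup>2 / \<bar>t\<bar> ^ 4) = cos_quartic_integral * Q"
    unfolding Q_def using has_bochner_integral_integral_eq[OF has_bochner_integral_exp_sum_quartic[OF c]] by simp
  then have "mixed_power n x = sqrt (12 / (2 * pi) * (cos_quartic_integral * Q))"
    unfolding mixed_power_def A3_eq by simp
  moreover have "peano_kernel n x u = (\<Sum>i\<in>?I. c i * max (y i - u) 0)" for u
    unfolding peano_kernel_def split[of "\<lambda>a b. a * max (b - u) 0"]
    by (simp add: sum_negf)
  then have "(LBINT u:{0..1}. \<bar>peano_kernel n x u\<bar>\<^sup>2) = Q / 12"
    unfolding Q_def set_lebesgue_integral_def
    using has_bochner_integral_integral_eq[OF has_bochner_integral_truncated_sum_squared[OF c y]] by simp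
  ultimately show "mixed_power n x = ?C * sqrt (LBINT u:{0..1}. \<bar>peano_kernel n x u\<bar>\<^sup>2)"
    by (simp flip: real_sqrt_mult)
qed

end
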